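(* Let $\mathbf{X}_\tau=(X_{\tau,1},X_{\tau,2},\ldots,X_{\tau,k})'$, $\tau=0,\ldots,T$, be a random return vector of $k$ risky assets and let $E(\mathbf{X}_\tau\mid\mathcal{F}_{\tau-1})=\boldsymbol{\mu}_\tau$ and $\mathrm{Var}(\mathbf{X}_\tau\mid\mathcal{F}_{\tau-1})=\boldsymbol{\Sigma}_\tau$, where $\boldsymbol{\Sigma}_\tau$ is positive definite. Consider the multi-period portfolio choice problem without riskless asset $$\max_{\{\mathbf{w}_s:\ \mathbf{w}_s'\mathbf{1}=1\}_{s=0}^{T-1}}E_0\Big[W_T-\frac{\alpha}{2}W_T^2\Big],\qquad W_t=W_{t-1}\,\mathbf{w}_{t-1}'\tilde{\mathbf{X}}_t .$$ Then for all $t=1,\ldots,T$ the optimal multi-period portfolio weights for the period $T-t$ are given by $$\mathbf{w}^*_{T-t}=\frac{\mathbf{A}^{-1}_{T-t+1}\mathbf{1}}{\mathbf{1}'\mathbf{A}^{-1}_{T-t+1}\mathbf{1}}+\frac{1}{\alpha W_{T-t}}\tilde{\mathbf{Q}}_{T-t+1}\tilde{\boldsymbol{\mu}}^*_{T-t+1},$$ with $$\tilde{\mathbf{Q}}_{T-t+1}=\mathbf{A}^{-1}_{T-t+1}-\frac{\mathbf{A}^{-1}_{T-t+1}\mathbf{1}\mathbf{1}'\mathbf{A}^{-1}_{T-t+1}}{\mathbf{1}'\mathbf{A}^{-1}_{T-t+1}\mathbf{1}},$$ $$\mathbf{A}_{T-t+1}=\begin{cases}\boldsymbol{\Sigma}_T+\tilde{\boldsymbol{\mu}}_T\tilde{\boldsymbol{\mu}}_T'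 & \text{for } t=1,\\ E_{T-t}\big[V_{T-t+2}\,\tilde{\mathbf{X}}_{T-t+1}\tilde{\mathbf{X}}_{T-t+1}'\big] & \text{for } t=2,\ldots,T,\end{cases}$$ $$\tilde{\boldsymbol{\mu}}^*_{T-t+1}=\begin{cases}\tilde{\boldsymbol{\mu}}_T & \text{for } t=1,\\ E_{T-t}\big[R_{T-t+2}\,\tilde{\mathbf{X}}_{T-t+1}\big] & \text{for } t=2,\ldots,T,\end{cases}$$ and $$R_{T-t+2}=\frac{\mathbf{1}'\mathbf{A}^{-1}_{T-t+2}\tilde{\boldsymbol{\mu}}^*_{T-t+2}}{\mathbf{1}'\mathbf{A}^{-1}_{T-t+2}\mathbf{1}},\qquad V_{T-t+2}=\frac{1}{\mathbf{1}'\mathbf{A}^{-1}_{T-t+2}\mathbf{1}}\qquad\text{for } t=2,\ldots,T.$$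
   Context: $\mathcal{F}_t$ denotes the information set available at time $t$, and $E_t(\cdot)$ is the expectation given $\mathcal{F}_t$. $\mathbf{1}$ is the $k$-vector of ones and $'$ denotes transpose. $\tilde{\mathbf{X}}_t=\mathbf{1}+\mathbf{X}_t$ and $\tilde{\boldsymbol{\mu}}_t=\mathbf{1}+\boldsymbol{\mu}_t$. No assumption is made on the distribution of the returns or on the correlation structure between different time points. The investor invests exclusively into the $k$ risky assets. The portfolio is allocated at time $0$ and reconstructed at times $1,\ldots,T-1$; $\mathbf{w}_t=(w_{t,1},\ldots,w_{t,k})'$ is the vector of portfolio weights in period $t$, with $\mathbf{w}_t'\mathbf{1}=1$, and short-selling is allowed (components may be negative). The wealth evolves as $W_t=W_{t-1}(1+\mathbf{w}_{t-1}'\mathbf{X}_t)=W_{t-1}\mathbf{w}_{t-1}'\tilde{\mathbf{X}}_t$. The utility function is $U(W)=W-\frac{\alpha}{2}W^2$ with $\alpha>0$, and the investor maximizes the expected utility of the final wealth $W_T$. The problem is solved recursively: the value function is $V(t,W_t,\mathcal{F}_t)=\max_{\{\mathbf{w}_s:\mathbf{w}_s'\mathbf{1}=1\}_{s=t}^{T-1}}E_t[U(W_T)]$, with $V(T,W_T,\mathcal{F}_T)=U(W_T)$, and the Bellman equation is $V(T-t,W_{T-t},\mathcal{F}_{T-t})=\max_{\mathbf{w}_{T-t}:\mathbf{w}_{T-t}'\mathbf{1}=1}E_{T-t}[V(T-t+1,W_{T-t}\mathbf{w}_{T-t}'\tilde{\mathbf{X}}_{T-t+1},\mathcal{F}_{T-t+1})]$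 for $t=1,\ldots,T$. The weights $\mathbf{w}^*_{T-t}$ are the optimal weights at time $T-t$, expressed through the current wealth $W_{T-t}$. (The value function $V(\cdot,\cdot,\cdot)$ is not to be confused with the scalars $V_{T-t+2}$ in the claim.)
   Formalization: The wealth W_t generated by the optimal weights is assumed almost surely nonzero at each rebalancing time (the formula divides by it, and the claim can fail otherwise); the conditional second moments and the expectations defining A are assumed finite. *)

theory Defs
  imports "HOL-Probability.Probability"
begin

subsection \<open>Conditional expectations\<close>

text \<open>
  \<open>f\<close> has a finite conditional expectation given \<open>G\<close>. On a probability space this is weaker
  than integrability of \<open>f\<close>.
\<close>

definition cond_integrable :: "'a measure \<Rightarrow> 'a measure \<Rightarrow> ('a \<Rightarrow> real) \<Rightarrow> bool" where
  "cond_integrable M G f \<longleftrightarrow> f \<in> borel_measurable M \<and>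
     (AE \<omega> in M. nn_cond_exp M G (\<lambda>x. ennreal \<bar>f x\<bar>) \<omega> < \<infinity>)"

text \<open>
  The conditional expectation with values in the extended reals, \<open>E(f\<^sup>+ | G) - E(f\<^sup>- | G)\<close>.
  It replaces the library's \<open>real_cond_exp\<close>, which maps an infinite \<open>E(f\<^sup>- | G)\<close> to \<open>0\<close>,
  where \<open>f\<close> is bounded above but need not be integrable.
\<close>

definition ereal_cond_exp :: "'a measure \<Rightarrow> 'a measure \<Rightarrow> ('a \<Rightarrow> real) \<Rightarrow> 'a \<Rightarrow> ereal" where
  "ereal_cond_exp M G f \<omega> =
     enn2ereal (nn_cond_exp M G (\<lambda>x. ennreal (f x)) \<omega>) -
     enn2ereal (nn_cond_exp M G (\<lambda>x. ennreal (- f x)) \<omega>)"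

definition cond_exp_vec :: "'a measure \<Rightarrow> 'a measure \<Rightarrow> ('a \<Rightarrow> real ^ 'k) \<Rightarrow> 'a \<Rightarrow> real ^ 'k" where
  "cond_exp_vec M G Y \<omega> = (\<chi> i. real_cond_exp M G (\<lambda>x. Y x $ i) \<omega>)"

definition cond_exp_mat ::
  "'a measure \<Rightarrow> 'a measure \<Rightarrow> ('a \<Rightarrow> real ^ 'k ^ 'k) \<Rightarrow> 'a \<Rightarrow> real ^ 'k ^ 'k" where
  "cond_exp_mat M G Y \<omega> = (\<chi> i j. real_cond_exp M G (\<lambda>x. Y x $ i $ j) \<omega>)"

definition outer :: "real ^ 'k \<Rightarrow> real ^ 'k \<Rightarrow> real ^ 'k ^ 'k" where
  "outer x y = (\<chi> i j. x $ i * y $ j)"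

definition cond_var :: "'a measure \<Rightarrow> 'a measure \<Rightarrow> ('a \<Rightarrow> real ^ 'k) \<Rightarrow> 'a \<Rightarrow> real ^ 'k ^ 'k" where
  "cond_var M G Y =
     cond_exp_mat M G (\<lambda>x. outer (Y x - cond_exp_vec M G Y x) (Y x - cond_exp_vec M G Y x))"

definition positive_definite :: "real ^ 'k ^ 'k \<Rightarrow> bool" where
  "positive_definite S \<longleftrightarrow> transpose S = S \<and> (\<forall>v. v \<noteq> 0 \<longrightarrow> v \<bullet> (S *v v) > 0)"

subsection \<open>The coefficients of the optimal weights\<close>

text \<open>
  Throughout, \<open>1 :: real ^ 'k\<close> is the vector of ones, so that \<open>1 + X \<tau> \<omega>\<close> is the vector of gross
  returns. \<open>A_mat\<close>, \<open>V_coef\<close> and \<open>mu_star\<close> are indexed by the period \<open>\<tau> = T - t + 1\<close> whose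
  returns they involve; \<open>A_mat\<close> and \<open>mu_star\<close> run backwards from \<open>\<tau> = T\<close>, and the value of all
  three at \<open>\<tau>\<close> is known at time \<open>\<tau> - 1\<close>. With \<open>B\<close> and \<open>m\<close> the values of \<open>A_mat\<close> and \<open>mu_star\<close>
  at \<open>\<tau>\<close>, the scalars \<open>V\<close> and \<open>R\<close> at \<open>\<tau>\<close> are \<open>V_of B\<close> and \<open>R_of B m\<close>.
\<close>

definition V_of :: "real ^ 'k ^ 'k \<Rightarrow> real" where
  "V_of B = 1 / (1 \<bullet> (matrix_inv B *v 1))"

definition R_of :: "real ^ 'k ^ 'k \<Rightarrow> real ^ 'k \<Rightarrow> real" where
  "R_of B m = (1 \<bullet> (matrix_inv B *v m)) / (1 \<bullet> (matrix_inv B *v 1))"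

definition Q_of :: "real ^ 'k ^ 'k \<Rightarrow> real ^ 'k ^ 'k" where
  "Q_of B = matrix_inv B -
     (1 / (1 \<bullet> (matrix_inv B *v 1))) *\<^sub>R (matrix_inv B ** outer 1 1 ** matrix_inv B)"

function A_mat :: "'a measure \<Rightarrow> (nat \<Rightarrow> 'a measure) \<Rightarrow> (nat \<Rightarrow> 'a \<Rightarrow> real ^ 'k) \<Rightarrow>
    (nat \<Rightarrow> 'a \<Rightarrow> real ^ 'k) \<Rightarrow> (nat \<Rightarrow> 'a \<Rightarrow> real ^ 'k ^ 'k) \<Rightarrow> nat \<Rightarrow> nat \<Rightarrow> 'a \<Rightarrow> real ^ 'k ^ 'k" where
  "A_mat M F X mu Cov T \<tau> =
     (if \<tau> < T then
        cond_exp_mat M (F (\<tau> - 1))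
          (\<lambda>\<omega>. V_of (A_mat M F X mu Cov T (\<tau> + 1) \<omega>) *\<^sub>R outer (1 + X \<tau> \<omega>) (1 + X \<tau> \<omega>))
      else (\<lambda>\<omega>. Cov T \<omega> + outer (1 + mu T \<omega>) (1 + mu T \<omega>)))"
  by pat_completeness auto
termination by (relation "Wellfounded.measure (\<lambda>(M, F, X, mu, Cov, T, \<tau>). T - \<tau>)") auto

declare A_mat.simps [simp del]

definition V_coef :: "'a measure \<Rightarrow> (nat \<Rightarrow> 'a measure) \<Rightarrow> (nat \<Rightarrow> 'a \<Rightarrow> real ^ 'k) \<Rightarrow>
    (nat \<Rightarrow> 'a \<Rightarrow> real ^ 'k) \<Rightarrow> (nat \<Rightarrow> 'a \<Rightarrow> real ^ 'k ^ 'k) \<Rightarrow> nat \<Rightarrow> nat \<Rightarrow> 'a \<Rightarrow> real" where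
  "V_coef M F X mu Cov T \<tau> \<omega> = V_of (A_mat M F X mu Cov T \<tau> \<omega>)"

function mu_star :: "'a measure \<Rightarrow> (nat \<Rightarrow> 'a measure) \<Rightarrow> (nat \<Rightarrow> 'a \<Rightarrow> real ^ 'k) \<Rightarrow>
    (nat \<Rightarrow> 'a \<Rightarrow> real ^ 'k) \<Rightarrow> (nat \<Rightarrow> 'a \<Rightarrow> real ^ 'k ^ 'k) \<Rightarrow> nat \<Rightarrow> nat \<Rightarrow> 'a \<Rightarrow> real ^ 'k" where
  "mu_star M F X mu Cov T \<tau> =
     (if \<tau> < T then
        cond_exp_vec M (F (\<tau> - 1))
          (\<lambda>\<omega>. R_of (A_mat M F X mu Cov T (\<tau> + 1) \<omega>) (mu_star M F X mu Cov T (\<tau> + 1) \<omega>)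
                 *\<^sub>R (1 + X \<tau> \<omega>))
      else (\<lambda>\<omega>. 1 + mu T \<omega>))"
  by pat_completeness auto
termination by (relation "Wellfounded.measure (\<lambda>(M, F, X, mu, Cov, T, \<tau>). T - \<tau>)") auto

declare mu_star.simps [simp del]

definition opt_weights :: "'a measure \<Rightarrow> (nat \<Rightarrow> 'a measure) \<Rightarrow> (nat \<Rightarrow> 'a \<Rightarrow> real ^ 'k) \<Rightarrow>
    (nat \<Rightarrow> 'a \<Rightarrow> real ^ 'k) \<Rightarrow> (nat \<Rightarrow> 'a \<Rightarrow> real ^ 'k ^ 'k) \<Rightarrow> real \<Rightarrow> nat \<Rightarrow>
    nat \<Rightarrow> real \<Rightarrow> 'a \<Rightarrow> real ^ 'k" where
  "opt_weights M F X mu Cov \<alpha> T u x \<omega> =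
     (let B = A_mat M F X mu Cov T (u + 1) \<omega>; m = mu_star M F X mu Cov T (u + 1) \<omega>
      in (1 / (1 \<bullet> (matrix_inv B *v 1))) *\<^sub>R (matrix_inv B *v 1) + (1 / (\<alpha> * x)) *\<^sub>R (Q_of B *v m))"

subsection \<open>The portfolio choice problem\<close>

definition utility :: "real \<Rightarrow> real \<Rightarrow> real" where
  "utility \<alpha> x = x - \<alpha> / 2 * x\<^sup>2"

text \<open>
  The wealth at time \<open>u\<close> of an investor who owns \<open>W\<close> at time \<open>s\<close> and then follows \<open>w\<close>; only the
  values at \<open>u \<ge> s\<close> are meaningful.
\<close>

primrec wealth :: "(nat \<Rightarrow> 'a \<Rightarrow> real ^ 'k) \<Rightarrow> nat \<Rightarrow> ('a \<Rightarrow> real) \<Rightarrow>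
    (nat \<Rightarrow> 'a \<Rightarrow> real ^ 'k) \<Rightarrow> nat \<Rightarrow> 'a \<Rightarrow> real" where
  "wealth X s W w 0 = W"
| "wealth X s W w (Suc u) =
     (if u < s then W else (\<lambda>\<omega>. wealth X s W w u \<omega> * (w u \<omega> \<bullet> (1 + X (Suc u) \<omega>))))"

text \<open>
  A feedback rule \<open>p u x \<omega>\<close> prescribes the weights at time \<open>u\<close> as a function of the wealth \<open>x\<close>
  held at that time; \<open>feedback_strategy\<close> is the strategy it generates from wealth \<open>W\<close> at time \<open>s\<close>.
\<close>

primrec feedback_wealth :: "(nat \<Rightarrow> 'a \<Rightarrow> real ^ 'k) \<Rightarrow> nat \<Rightarrow> ('a \<Rightarrow> real) \<Rightarrow>
    (nat \<Rightarrow> real \<Rightarrow> 'a \<Rightarrow> real ^ 'k) \<Rightarrow> nat \<Rightarrow> 'a \<Rightarrow> real" where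
  "feedback_wealth X s W p 0 = W"
| "feedback_wealth X s W p (Suc u) =
     (if u < s then W
      else (\<lambda>\<omega>. feedback_wealth X s W p u \<omega> *
                 (p u (feedback_wealth X s W p u \<omega>) \<omega> \<bullet> (1 + X (Suc u) \<omega>))))"

definition feedback_strategy :: "(nat \<Rightarrow> 'a \<Rightarrow> real ^ 'k) \<Rightarrow> nat \<Rightarrow> ('a \<Rightarrow> real) \<Rightarrow>
    (nat \<Rightarrow> real \<Rightarrow> 'a \<Rightarrow> real ^ 'k) \<Rightarrow> nat \<Rightarrow> 'a \<Rightarrow> real ^ 'k" where
  "feedback_strategy X s W p u \<omega> = p u (feedback_wealth X s W p u \<omega>) \<omega>"

definition strategy :: "'a measure \<Rightarrow> (nat \<Rightarrow> 'a measure) \<Rightarrow> nat \<Rightarrow> nat \<Rightarrow>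
    (nat \<Rightarrow> 'a \<Rightarrow> real ^ 'k) \<Rightarrow> bool" where
  "strategy M F T s w \<longleftrightarrow>
     (\<forall>u\<in>{s..<T}. w u \<in> borel_measurable (F u) \<and> (AE \<omega> in M. w u \<omega> \<bullet> 1 = 1))"

definition optimal_strategy :: "'a measure \<Rightarrow> (nat \<Rightarrow> 'a measure) \<Rightarrow> (nat \<Rightarrow> 'a \<Rightarrow> real ^ 'k) \<Rightarrow>
    real \<Rightarrow> nat \<Rightarrow> nat \<Rightarrow> ('a \<Rightarrow> real) \<Rightarrow> (nat \<Rightarrow> 'a \<Rightarrow> real ^ 'k) \<Rightarrow> bool" where
  "optimal_strategy M F X \<alpha> T s W w \<longleftrightarrow> strategy M F T s w \<and>
     (\<forall>v. strategy M F T s v \<longrightarrow>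
        (AE \<omega> in M. ereal_cond_exp M (F s) (\<lambda>x. utility \<alpha> (wealth X s W v T x)) \<omega>
                  \<le> ereal_cond_exp M (F s) (\<lambda>x. utility \<alpha> (wealth X s W w T x)) \<omega>))"

end

theory Submission
  imports Defs
begin

text \<open>
  Up to a constant, the utility is \<open>- \<alpha> / 2 * (W - b)\<^sup>2\<close> with \<open>b = 1 / \<alpha>\<close>, so the investor minimises
  the conditional expectation of a nonnegative function, which always exists in \<open>[0, \<infinity>]\<close>. With \<open>V\<close>
  and \<open>R\<close> the coefficients of the period that starts at time \<open>u\<close> (both \<open>1\<close> at time \<open>T\<close>), put
  \<open>G\<^sub>u x = V x\<^sup>2 - 2 b R x + b\<^sup>2\<close>; the conditional Cauchy-Schwarz inequality gives \<open>R\<^sup>2 \<le> V\<close> by backward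
  induction, whence \<open>G\<^sub>u \<ge> 0\<close>. Let \<open>y\<close> be the vector of amounts invested at time \<open>u\<close> out of wealth \<open>x\<close>,
  and let \<open>B\<close>, \<open>m\<close> be the values of \<open>A_mat\<close> and \<open>mu_star\<close>. Completing the square under the constraint
  \<open>y \<bullet> 1 = x\<close> yields \<open>E\<^sub>u[G\<^sub>u\<^sub>+\<^sub>1 (y \<bullet> Z)] + b\<^sup>2 (m \<bullet> Q m) = G\<^sub>u x + (y - y*) \<bullet> B (y - y*)\<close>,
  where \<open>Z\<close> is the gross return, \<open>y*\<close> is the amount prescribed by the optimal weights and the second
  term lies between \<open>0\<close> and \<open>b\<^sup>2\<close>. Summing over the periods, the expected loss exceeds a finite quantity
  that does not depend on the strategy by the expected sum of the last terms. A strategy is therefore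
  optimal iff all of them vanish, and where the wealth is not \<open>0\<close> this determines the weights.
\<close>

subsection \<open>Positive definite matrices\<close>

text \<open>Almost sure statements can be combined over countably many vectors only. The failure set
  of a closed condition is open, so it meets \<open>D\<close> unless it is empty; checking
  \<open>D\<close> therefore settles all vectors.\<close>

lemma countable_dense_closedE:
  fixes P :: "'b::second_countable_topology \<Rightarrow> bool"
  obtains D :: "'b set" where "countable D"
    "\<And>P. closed {v. P v} \<Longrightarrow> (\<And>v. v \<in> D \<Longrightarrow> P v) \<Longrightarrow> (\<forall>v. P v)"
proof -
  obtain D :: "'b set" where D: "countable D" "\<And>X. open X \<Longrightarrow> X \<noteq> {} \<Longrightarrow> \<exists>d\<in>D. d \<in> X"
    by (rule countable_dense_setE) blast
  show thesis
  proof (rule that[OF D(1)])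
    fix P :: "'b \<Rightarrow> bool" assume c: "closed {v. P v}" and P: "\<And>v. v \<in> D \<Longrightarrow> P v"
    show "\<forall>v. P v"
      using D(2)[of "- {v. P v}"] c P by (auto simp: open_Compl)
  qed
qed

section \<open>Measurability of the inverse and of other matrix operations\<close>

lemma matrix_inv_singular_constant:
  fixes A :: "real ^ 'k ^ 'k"
  assumes "\<not> invertible A"
  shows "matrix_inv A = (SOME A'. False)"
proof -
  have "(\<lambda>A'. A ** A' = mat 1 \<and> A' ** A = mat 1) = (\<lambda>_. False)"
    using assms by (auto simp: invertible_def)
  then show ?thesis unfolding matrix_inv_def by (rule arg_cong)
qed

lemma matrix_inv_mult:
  fixes A :: "real ^ 'k ^ 'k"
  assumes "invertible A"
  shows "A ** matrix_inv A = mat 1" "matrix_inv A ** A = mat 1"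
proof -
  have "A ** matrix_inv A = mat 1 \<and> matrix_inv A ** A = mat 1"
    unfolding matrix_inv_def by (rule someI_ex) (use assms in \<open>auto simp: invertible_def\<close>)
  then show "A ** matrix_inv A = mat 1" "matrix_inv A ** A = mat 1" by auto
qed

text \<open>Column \<open>j\<close> of the inverse solves the linear system with right-hand side
  \<open>axis j 1\<close>. Cramer's rule makes every entry a quotient of determinants, which are
  polynomials in the entries of \<open>A\<close>.\<close>

lemma matrix_inv_cramer:
  fixes A :: "real ^ 'k ^ 'k"
  assumes "det A \<noteq> 0"
  shows "matrix_inv A $ i $ j = det (\<chi> k l. if l = i then axis j 1 $ k else A $ k $ l) / det A"
proof -
  have "invertible A" using assms invertible_det_nz by blast
  then have "A *v (matrix_inv A *v axis j 1) = axis j 1"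
    by (simp add: matrix_vector_mul_assoc matrix_inv_mult)
  then have "matrix_inv A *v axis j 1 =
      (\<chi> i. det (\<chi> k l. if l = i then axis j 1 $ k else A $ k $ l) / det A)"
    using cramer[OF assms] by blast
  moreover have "matrix_inv A $ i $ j = (matrix_inv A *v axis j 1) $ i"
    by (simp add: matrix_vector_mult_basis column_def)
  ultimately show ?thesis by (simp only: vec_lambda_beta)
qed

lemma borel_measurable_vec_iff:
  fixes f :: "'a \<Rightarrow> real ^ 'k"
  shows "f \<in> borel_measurable M \<longleftrightarrow> (\<forall>i. (\<lambda>x. f x $ i) \<in> borel_measurable M)"
  by (subst borel_measurable_euclidean_space)
     (auto simp: Basis_vec_def inner_axis)

lemma borel_measurable_mat_iff:
  fixes f :: "'a \<Rightarrow> real ^ 'k ^ 'm"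
  shows "f \<in> borel_measurable M \<longleftrightarrow> (\<forall>i j. (\<lambda>x. f x $ i $ j) \<in> borel_measurable M)"
  by (subst borel_measurable_euclidean_space)
     (auto simp: Basis_vec_def inner_axis)

lemma borel_measurable_det [measurable (raw)]:
  fixes f :: "'a \<Rightarrow> real ^ 'k ^ 'k"
  assumes "f \<in> borel_measurable M"
  shows "(\<lambda>x. det (f x)) \<in> borel_measurable M"
proof -
  have [measurable]: "(\<lambda>x. f x $ i $ j) \<in> borel_measurable M" for i j
    using assms borel_measurable_mat_iff by blast
  show ?thesis unfolding det_def by measurable
qed

text \<open>\<open>matrix_inv\<close> is a choice term. On singular matrices the choice is from an
  unsatisfiable predicate and so has one constant value; on the measurable set where the determinant
  is nonzero Cramer's rule applies.\<close>

lemma borel_measurable_matrix_inv [measurable (raw)]: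
  fixes f :: "'a \<Rightarrow> real ^ 'k ^ 'k"
  assumes f [measurable]: "f \<in> borel_measurable M"
  shows "(\<lambda>x. matrix_inv (f x)) \<in> borel_measurable M"
proof -
  have [measurable]: "(\<lambda>x. f x $ i $ j) \<in> borel_measurable M" for i j
    using f borel_measurable_mat_iff by blast
  have eq: "(\<lambda>x. matrix_inv (f x) $ i $ j) =
      (\<lambda>x. if det (f x) = 0 then (SOME A'. False :: real ^ 'k ^ 'k) $ i $ j else
        det (\<chi> k l. if l = i then axis j 1 $ k else f x $ k $ l) / det (f x))" for i j
  proof
    fix x show "matrix_inv (f x) $ i $ j =
      (if det (f x) = 0 then (SOME A'. False :: real ^ 'k ^ 'k) $ i $ j else
        det (\<chi> k l. if l = i then axis j 1 $ k else f x $ k $ l) / det (f x))"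
      using matrix_inv_singular_constant[of "f x"] matrix_inv_cramer[of "f x"] invertible_det_nz[of "f x"]
      by presburger
  qed
  have [measurable]: "(\<lambda>x. det (\<chi> k l. if l = i then axis j 1 $ k else f x $ k $ l)) \<in> borel_measurable M"
    for i j by (rule borel_measurable_det) (simp add: borel_measurable_mat_iff)
  show ?thesis unfolding borel_measurable_mat_iff eq by measurable
qed

lemma borel_measurable_matrix_vector_mult [measurable (raw)]:
  fixes f :: "'a \<Rightarrow> real ^ 'k ^ 'm"
  assumes f: "f \<in> borel_measurable M" and g: "g \<in> borel_measurable M"
  shows "(\<lambda>x. f x *v g x) \<in> borel_measurable M"
proof -
  have [measurable]: "(\<lambda>x. f x $ i $ j) \<in> borel_measurable M" "(\<lambda>x. g x $ j) \<in> borel_measurable M" for i j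
    using f g borel_measurable_mat_iff borel_measurable_vec_iff by blast+
  show ?thesis unfolding borel_measurable_vec_iff by (simp add: matrix_vector_mult_def)
qed

lemma borel_measurable_outer [measurable (raw)]:
  fixes f :: "'a \<Rightarrow> real ^ 'k"
  assumes f: "f \<in> borel_measurable M" and g: "g \<in> borel_measurable M"
  shows "(\<lambda>x. outer (f x) (g x)) \<in> borel_measurable M"
proof -
  have [measurable]: "(\<lambda>x. f x $ j) \<in> borel_measurable M" "(\<lambda>x. g x $ j) \<in> borel_measurable M" for j
    using f g borel_measurable_vec_iff by blast+
  show ?thesis unfolding borel_measurable_mat_iff by (simp add: outer_def)
qed

lemma outer_mult_vec: "outer x y *v v = (y \<bullet> v) *\<^sub>R x"
  by (simp add: vec_eq_iff outer_def matrix_vector_mult_def inner_vec_def sum_distrib_left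
      sum_distrib_right mult_ac)

text \<open>The rank-one correction in \<open>Q_of\<close> only subtracts a multiple of
  \<open>matrix_inv B *v 1\<close>. This form avoids matrix products, both in the algebra and in the
  measurability proofs.\<close>

lemma Q_of_mult: "Q_of B *v m = matrix_inv B *v m - R_of B m *\<^sub>R (matrix_inv B *v 1)"
  by (simp add: Q_of_def R_of_def matrix_vector_mult_diff_rdistrib scaleR_matrix_vector_assoc[symmetric]
      matrix_vector_mul_assoc[symmetric] outer_mult_vec matrix_vector_mult_scaleR)

lemma borel_measurable_R_of [measurable (raw)]:
  assumes [measurable]: "f \<in> borel_measurable M" "g \<in> borel_measurable M"
  shows "(\<lambda>x. R_of (f x) (g x)) \<in> borel_measurable M"
  unfolding R_of_def by measurable

lemma borel_measurable_V_of [measurable (raw)]: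
  assumes [measurable]: "f \<in> borel_measurable M"
  shows "(\<lambda>x. V_of (f x)) \<in> borel_measurable M"
  unfolding V_of_def by measurable

lemma inner_matrix_vector_sum:
  fixes A :: "real ^ 'k ^ 'm"
  shows "v \<bullet> (A *v w) = (\<Sum>i\<in>UNIV. \<Sum>j\<in>UNIV. v $ i * w $ j * A $ i $ j)"
  by (simp add: inner_vec_def matrix_vector_mult_def sum_distrib_left ac_simps)

text \<open>\<open>opt_amount b B m x\<close> is the minimiser of \<open>y \<bullet> (B *v y) - 2 * b * (y \<bullet> m)\<close> over \<open>y \<bullet> 1 = x\<close>.
  For \<open>x \<noteq> 0\<close> and \<open>b = 1 / \<alpha>\<close> it is \<open>x\<close> times the optimal weights, but it also makes sense at \<open>x = 0\<close>.\<close>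

definition opt_amount :: "real \<Rightarrow> real ^ 'k ^ 'k \<Rightarrow> real ^ 'k \<Rightarrow> real \<Rightarrow> real ^ 'k" where
  "opt_amount b B m x = (x * V_of B) *\<^sub>R (matrix_inv B *v 1) + b *\<^sub>R (Q_of B *v m)"

section \<open>Completing the square for a positive definite matrix\<close>

context
  fixes B :: "real ^ 'k ^ 'k"
  assumes pd: "positive_definite B"
begin

lemma pd_invertible: "invertible B"
proof -
  have "x = 0" if "B *v x = 0" for x
    using pd that unfolding positive_definite_def by (metis inner_zero_right less_irrefl)
  then have "\<exists>C. C ** B = mat 1" by (simp add: matrix_left_invertible_ker)
  then show ?thesis by (simp add: invertible_left_inverse)
qed

lemma pd_inner_commute: "x \<bullet> (B *v y) = (B *v x) \<bullet> y"
proof -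
  have "transpose B = B" using pd by (simp add: positive_definite_def)
  then show ?thesis by (metis dot_lmul_matrix vector_transpose_matrix)
qed

lemma pd_mult_matrix_inv: "B *v (matrix_inv B *v x) = x"
  using matrix_inv_mult[OF pd_invertible] by (simp add: matrix_vector_mul_assoc)

lemma pd_matrix_inv_commute: "x \<bullet> (matrix_inv B *v y) = (matrix_inv B *v x) \<bullet> y"
  by (metis pd_inner_commute pd_mult_matrix_inv)

lemma pd_quadratic_nonneg: "0 \<le> x \<bullet> (B *v x)"
  using pd unfolding positive_definite_def by (cases "x = 0") (auto intro: less_imp_le)

lemma pd_quadratic_eq_0: "x \<bullet> (B *v x) = 0 \<longleftrightarrow> x = 0"
  using pd unfolding positive_definite_def by (metis inner_zero_left less_irrefl)

text \<open>With \<open>z = matrix_inv B *v 1\<close> this is the quadratic form of \<open>B\<close>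
  at the nonzero vector \<open>z\<close>. It justifies the divisions in \<open>V_of\<close> and
  \<open>R_of\<close>.\<close>

lemma pd_inverse_sum_pos: "0 < 1 \<bullet> (matrix_inv B *v 1)"
proof -
  let ?z = "matrix_inv B *v (1 :: real ^ 'k)"
  have "?z \<noteq> 0"
    using pd_mult_matrix_inv[of 1] by (metis matrix_vector_mult_0_right zero_neq_one)
  then have "0 < ?z \<bullet> (B *v ?z)" using pd by (simp add: positive_definite_def)
  then show ?thesis by (simp add: pd_mult_matrix_inv inner_commute)
qed

lemma V_of_pos: "0 < V_of B"
  using pd_inverse_sum_pos by (simp add: V_of_def)

lemma V_of_mult: "V_of B * (1 \<bullet> (matrix_inv B *v 1)) = 1"
  using pd_inverse_sum_pos by (simp add: V_of_def)

lemma R_of_eq: "R_of B m = V_of B * (1 \<bullet> (matrix_inv B *v m))"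
  by (simp add: R_of_def V_of_def)

lemma mult_Q_of: "B *v (Q_of B *v m) = m - R_of B m *\<^sub>R 1"
  by (simp add: Q_of_mult matrix_vector_mult_diff_distrib matrix_vector_mult_scaleR pd_mult_matrix_inv)

lemma sum_Q_of: "1 \<bullet> (Q_of B *v m) = 0"
  using V_of_mult by (simp add: Q_of_mult inner_diff_right R_of_eq)

lemma inner_Q_of: "m \<bullet> (Q_of B *v m) = m \<bullet> (matrix_inv B *v m) - (R_of B m) * (1 \<bullet> (matrix_inv B *v m))"
  using pd_matrix_inv_commute[of m 1]
  by (simp add: Q_of_mult inner_diff_right inner_commute)

text \<open>By \<open>mult_Q_of\<close> and \<open>sum_Q_of\<close> this number is the quadratic
  form of \<open>B\<close> at \<open>Q_of B *v m\<close>.\<close>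

lemma inner_Q_of_nonneg: "0 \<le> m \<bullet> (Q_of B *v m)"
  using pd_quadratic_nonneg[of "Q_of B *v m"] sum_Q_of[of m]
  by (simp add: mult_Q_of inner_diff_right inner_commute)

text \<open>The two sides differ by \<open>V_of B\<close> times a square.\<close>

lemma inner_Q_of_le: "m \<bullet> (Q_of B *v m) \<le> m \<bullet> (matrix_inv B *v m)"
  using V_of_pos by (simp add: inner_Q_of R_of_eq mult.assoc)

text \<open>This is the Cauchy-Schwarz inequality for \<open>1\<close> and \<open>m\<close> in the
  inner product given by the inverse of \<open>B\<close>, read off from
  \<open>inner_Q_of_nonneg\<close> and rescaled by \<open>V_of B\<close>.\<close>

lemma R_of_square_le: "(R_of B m)\<^sup>2 \<le> V_of B * (m \<bullet> (matrix_inv B *v m))"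
proof -
  have "V_of B * (1 \<bullet> (matrix_inv B *v m))\<^sup>2 \<le> m \<bullet> (matrix_inv B *v m)"
    using inner_Q_of_nonneg[of m] by (simp add: inner_Q_of R_of_eq power2_eq_square mult_ac)
  then have "V_of B * (V_of B * (1 \<bullet> (matrix_inv B *v m))\<^sup>2) \<le> V_of B * (m \<bullet> (matrix_inv B *v m))"
    using V_of_pos by simp
  then show ?thesis by (simp add: R_of_eq power2_eq_square mult_ac)
qed

text \<open>For \<open>q = m \<bullet> (matrix_inv B *v m)\<close> the hypothesis says that the
  square of \<open>q\<close> is at most \<open>q\<close>. The conditional Cauchy-Schwarz inequality
  will supply it.\<close>

lemma pd_inverse_quadratic_le_1:
  assumes "((matrix_inv B *v m) \<bullet> m)\<^sup>2 \<le> (matrix_inv B *v m) \<bullet> (B *v (matrix_inv B *v m))"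
  shows "m \<bullet> (matrix_inv B *v m) \<le> 1"
proof -
  let ?q = "m \<bullet> (matrix_inv B *v m)"
  have "?q * ?q \<le> ?q"
    using assms by (simp add: pd_mult_matrix_inv inner_commute power2_eq_square)
  then show ?thesis using mult_strict_right_mono[of 1 ?q ?q] by fastforce
qed

lemma sum_opt_amount: "opt_amount b B m x \<bullet> 1 = x"
  using V_of_mult sum_Q_of[of m] by (simp add: opt_amount_def inner_add_right inner_commute[of _ 1] mult.assoc)

lemma complete_square:
  assumes "y \<bullet> 1 = x"
  shows "y \<bullet> (B *v y) - 2 * b * (y \<bullet> m) + b\<^sup>2 * (m \<bullet> (Q_of B *v m)) =
    V_of B * x\<^sup>2 - 2 * b * R_of B m * x +
    (y - opt_amount b B m x) \<bullet> (B *v (y - opt_amount b B m x))"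
proof -
  define z where "z = opt_amount b B m x"
  \<comment> \<open>The first-order condition under the constraint: up to the multiplier times
    \<open>1\<close>, the vector \<open>B *v z\<close> is \<open>b *\<^sub>R m\<close>. On the
    hyperplane the cross term therefore depends on \<open>y\<close> only through
    \<open>y \<bullet> m\<close> and cancels the linear term.\<close>
  have Bz: "B *v z = (x * V_of B - b * R_of B m) *\<^sub>R 1 + b *\<^sub>R m"
    by (simp add: z_def opt_amount_def matrix_vector_right_distrib matrix_vector_mult_scaleR
        mult_Q_of pd_mult_matrix_inv scaleR_diff_left scaleR_diff_right)
  have yBz: "v \<bullet> (B *v z) = (x * V_of B - b * R_of B m) * x + b * (v \<bullet> m)" if "v \<bullet> 1 = x" for v
    using that by (simp add: Bz inner_add_right)
  have z1: "z \<bullet> 1 = x" by (simp add: z_def sum_opt_amount)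
  have zm: "z \<bullet> m = x * R_of B m + b * (m \<bullet> (Q_of B *v m))"
    by (simp add: z_def opt_amount_def inner_add_right R_of_eq inner_commute[of _ m]
        pd_matrix_inv_commute[of 1 m])
  have "(y - z) \<bullet> (B *v (y - z)) = y \<bullet> (B *v y) - 2 * (y \<bullet> (B *v z)) + z \<bullet> (B *v z)"
    using pd_inner_commute[of z y]
    by (simp add: matrix_vector_mult_diff_distrib inner_diff_left inner_diff_right inner_commute)
  then show ?thesis
    unfolding z_def[symmetric] yBz[OF assms] yBz[OF z1] zm
    by (simp add: algebra_simps power2_eq_square)
qed

end

text \<open>The added matrix contributes the square of \<open>v \<bullet> x\<close>. With
  \<open>v\<close> the mean gross return, this passes from the covariance matrix to the second
  moment.\<close>

lemma positive_definite_add_outer: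
  assumes "positive_definite C"
  shows "positive_definite (C + outer v v)"
proof -
  have "transpose (outer v v) = outer v v" by (simp add: transpose_def outer_def vec_eq_iff mult.commute)
  moreover have "transpose (C + outer v v) = transpose C + transpose (outer v v)"
    by (simp add: transpose_def vec_eq_iff)
  moreover have "0 < x \<bullet> ((C + outer v v) *v x)" if "x \<noteq> 0" for x
  proof -
    have "x \<bullet> ((C + outer v v) *v x) = x \<bullet> (C *v x) + (v \<bullet> x)\<^sup>2"
      by (simp add: matrix_vector_mult_add_rdistrib outer_mult_vec inner_add_right power2_eq_square inner_commute)
    then show ?thesis using assms that by (simp add: positive_definite_def add_pos_nonneg)
  qed
  ultimately show ?thesis using assms by (simp add: positive_definite_def)
qed

subsection \<open>Conditional expectations without integrability\<close>

text \<open>\<open>g\<close> stands for a value of the conditional expectation and need not be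
  measurable, only almost surely equal to the chosen version. The relation supports linearity and
  factoring out known quantities without integrability over \<open>M\<close>.\<close>

definition has_cond_exp :: "'a measure \<Rightarrow> 'a measure \<Rightarrow> ('a \<Rightarrow> real) \<Rightarrow> ('a \<Rightarrow> real) \<Rightarrow> bool" where
  "has_cond_exp M G f g \<longleftrightarrow> cond_integrable M G f \<and> (AE \<omega> in M. real_cond_exp M G f \<omega> = g \<omega>)"

lemma has_cond_exp_measurable: "has_cond_exp M G f g \<Longrightarrow> f \<in> borel_measurable M"
  by (simp add: has_cond_exp_def cond_integrable_def)

lemma cond_integrable_measurable: "cond_integrable M G f \<Longrightarrow> f \<in> borel_measurable M"
  by (simp add: cond_integrable_def)

lemma cond_integrable_has_cond_exp:
  "cond_integrable M G f \<Longrightarrow> has_cond_exp M G f (real_cond_exp M G f)"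
  by (simp add: has_cond_exp_def)

lemma has_cond_exp_cong_AE:
  assumes "has_cond_exp M G f g" "AE \<omega> in M. g \<omega> = g' \<omega>"
  shows "has_cond_exp M G f g'"
  using assms unfolding has_cond_exp_def by (auto elim: AE_mp)

context sigma_finite_subalgebra
begin

lemma cond_integrable_bound:
  assumes h: "cond_integrable M F h" and f [measurable]: "f \<in> borel_measurable M"
    and le: "AE x in M. \<bar>f x\<bar> \<le> h x"
  shows "cond_integrable M F f"
proof -
  have [measurable]: "h \<in> borel_measurable M" using h by (rule cond_integrable_measurable)
  have "AE x in M. nn_cond_exp M F (\<lambda>x. ennreal \<bar>f x\<bar>) x \<le> nn_cond_exp M F (\<lambda>x. ennreal \<bar>h x\<bar>) x"
    by (rule nn_cond_exp_mono) (use le in \<open>auto intro!: ennreal_leI\<close>)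
  then show ?thesis using h unfolding cond_integrable_def by (auto intro: le_less_trans)
qed

text \<open>All later rules reduce to this one. \<open>real_cond_exp\<close> is built from the
  positive and negative parts of a function, while \<open>a\<close> and \<open>b\<close> may be any
  nonnegative functions with the right difference; finiteness of \<open>a'\<close> and
  \<open>b'\<close> makes the result independent of the decomposition.\<close>

lemma has_cond_exp_diff_nonneg:
  assumes [measurable]: "a \<in> borel_measurable M" "b \<in> borel_measurable M"
    and nonneg: "\<And>x. 0 \<le> a x" "\<And>x. 0 \<le> b x"
    and A: "AE x in M. nn_cond_exp M F (\<lambda>x. ennreal (a x)) x = ennreal (a' x)" "\<And>x. 0 \<le> a' x"
    and B: "AE x in M. nn_cond_exp M F (\<lambda>x. ennreal (b x)) x = ennreal (b' x)" "\<And>x. 0 \<le> b' x"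
  shows "has_cond_exp M F (\<lambda>x. a x - b x) (\<lambda>x. a' x - b' x)"
proof -
  let ?f = "\<lambda>x. a x - b x"
  \<comment> \<open>The identity of differences is rewritten as an identity of sums, to which
    additivity in \<open>ennreal\<close> applies.\<close>
  have eq: "(\<lambda>x. ennreal (?f x) + ennreal (b x)) = (\<lambda>x. ennreal (- ?f x) + ennreal (a x))"
  proof
    fix x show "ennreal (?f x) + ennreal (b x) = ennreal (- ?f x) + ennreal (a x)"
      using nonneg[of x] by (cases "b x \<le> a x") (auto simp: ennreal_neg ennreal_plus[symmetric] simp del: ennreal_plus)
  qed
  have 1: "AE x in M. nn_cond_exp M F (\<lambda>x. ennreal (?f x)) x + nn_cond_exp M F (\<lambda>x. ennreal (b x)) x =
      nn_cond_exp M F (\<lambda>x. ennreal (- ?f x)) x + nn_cond_exp M F (\<lambda>x. ennreal (a x)) x"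
    using nn_cond_exp_sum[of "\<lambda>x. ennreal (?f x)" "\<lambda>x. ennreal (b x)"]
      nn_cond_exp_sum[of "\<lambda>x. ennreal (- ?f x)" "\<lambda>x. ennreal (a x)"]
    unfolding eq by (auto elim!: AE_mp)
  have 2: "AE x in M. nn_cond_exp M F (\<lambda>x. ennreal (?f x)) x \<le> nn_cond_exp M F (\<lambda>x. ennreal (a x)) x"
    by (rule nn_cond_exp_mono) (use nonneg in \<open>auto intro!: ennreal_leI\<close>)
  have 3: "AE x in M. nn_cond_exp M F (\<lambda>x. ennreal (- ?f x)) x \<le> nn_cond_exp M F (\<lambda>x. ennreal (b x)) x"
    by (rule nn_cond_exp_mono) (use nonneg in \<open>auto intro!: ennreal_leI\<close>)
  have 4: "AE x in M. nn_cond_exp M F (\<lambda>x. ennreal \<bar>?f x\<bar>) x \<le>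
      nn_cond_exp M F (\<lambda>x. ennreal (a x) + ennreal (b x)) x"
    by (rule nn_cond_exp_mono)
       (use nonneg in \<open>auto intro!: ennreal_leI simp: ennreal_plus[symmetric] abs_le_iff simp del: ennreal_plus\<close>)
  have 5: "AE x in M. nn_cond_exp M F (\<lambda>x. ennreal (a x)) x + nn_cond_exp M F (\<lambda>x. ennreal (b x)) x =
      nn_cond_exp M F (\<lambda>x. ennreal (a x) + ennreal (b x)) x"
    by (rule nn_cond_exp_sum) auto
  have "AE x in M. nn_cond_exp M F (\<lambda>x. ennreal \<bar>?f x\<bar>) x < \<infinity>"
    using 4 5 A(1) B(1)
  proof eventually_elim
    case (elim x)
    then have "nn_cond_exp M F (\<lambda>x. ennreal \<bar>?f x\<bar>) x \<le> ennreal (a' x + b' x)"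
      using A(2)[of x] B(2)[of x] by simp
    then show ?case by (rule le_less_trans) simp
  qed
  moreover have "AE x in M. real_cond_exp M F ?f x = a' x - b' x"
    using 1 2 3 A(1) B(1)
  proof eventually_elim
    case (elim x)
    obtain p where p: "nn_cond_exp M F (\<lambda>x. ennreal (?f x)) x = ennreal p" "0 \<le> p"
      using elim(2,4) by (cases "nn_cond_exp M F (\<lambda>x. ennreal (?f x)) x") (auto simp: top_unique)
    obtain q where q: "nn_cond_exp M F (\<lambda>x. ennreal (- ?f x)) x = ennreal q" "0 \<le> q"
      using elim(3,5) by (cases "nn_cond_exp M F (\<lambda>x. ennreal (- ?f x)) x") (auto simp: top_unique)
    note pq = p q
    then have "p + b' x = q + a' x"
      using elim A(2)[of x] B(2)[of x] by (simp flip: ennreal_plus)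
    then show ?case unfolding real_cond_exp_def using pq by simp
  qed
  ultimately show ?thesis by (simp add: has_cond_exp_def cond_integrable_def)
qed

text \<open>This supplies real-valued conditional expectations of both parts, so that operations can
  be carried out on nonnegative functions and reassembled by
  \<open>has_cond_exp_diff_nonneg\<close>.\<close>

lemma has_cond_exp_parts:
  assumes "has_cond_exp M F f g"
  obtains p q where "\<And>x. 0 \<le> p x" "\<And>x. 0 \<le> q x"
    "AE x in M. nn_cond_exp M F (\<lambda>x. ennreal (max (f x) 0)) x = ennreal (p x)"
    "AE x in M. nn_cond_exp M F (\<lambda>x. ennreal (max (- f x) 0)) x = ennreal (q x)"
    "AE x in M. g x = p x - q x"
proof -
  have [measurable]: "f \<in> borel_measurable M" using assms by (rule has_cond_exp_measurable)
  have eq: "ennreal (max t 0) = ennreal t" for t by (cases "0 \<le> t") (auto simp: ennreal_neg)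
  have 1: "AE x in M. nn_cond_exp M F (\<lambda>x. ennreal \<bar>f x\<bar>) x < \<infinity>"
    using assms by (simp add: has_cond_exp_def cond_integrable_def)
  have 2: "AE x in M. nn_cond_exp M F (\<lambda>x. ennreal (f x)) x \<le> nn_cond_exp M F (\<lambda>x. ennreal \<bar>f x\<bar>) x"
    by (rule nn_cond_exp_mono) (auto intro!: ennreal_leI)
  have 3: "AE x in M. nn_cond_exp M F (\<lambda>x. ennreal (- f x)) x \<le> nn_cond_exp M F (\<lambda>x. ennreal \<bar>f x\<bar>) x"
    by (rule nn_cond_exp_mono) (auto intro!: ennreal_leI)
  show thesis
  proof (rule that[of "\<lambda>x. enn2real (nn_cond_exp M F (\<lambda>x. ennreal (f x)) x)"
        "\<lambda>x. enn2real (nn_cond_exp M F (\<lambda>x. ennreal (- f x)) x)"])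
    show "AE x in M. g x = enn2real (nn_cond_exp M F (\<lambda>x. ennreal (f x)) x) -
        enn2real (nn_cond_exp M F (\<lambda>x. ennreal (- f x)) x)"
      using assms unfolding has_cond_exp_def real_cond_exp_def by (auto elim!: AE_mp)
  qed (use 1 2 3 in \<open>auto simp: eq elim!: AE_mp\<close>)
qed

text \<open>The negative part vanishes almost surely and so does its conditional expectation. This
  links the real-valued calculus to \<open>nn_cond_exp\<close>.\<close>

lemma has_cond_exp_nonneg:
  assumes "has_cond_exp M F f g" "AE x in M. 0 \<le> f x"
  shows "AE x in M. nn_cond_exp M F (\<lambda>x. ennreal (f x)) x = ennreal (g x)"
    and "AE x in M. 0 \<le> g x"
proof -
  have [measurable]: "f \<in> borel_measurable M" using assms by (auto intro: has_cond_exp_measurable)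
  obtain p q where pq: "\<And>x. 0 \<le> p x" "\<And>x. 0 \<le> q x"
    "AE x in M. nn_cond_exp M F (\<lambda>x. ennreal (max (f x) 0)) x = ennreal (p x)"
    "AE x in M. nn_cond_exp M F (\<lambda>x. ennreal (max (- f x) 0)) x = ennreal (q x)"
    "AE x in M. g x = p x - q x"
    by (rule has_cond_exp_parts[OF assms(1)]) blast
  have 1: "AE x in M. nn_cond_exp M F (\<lambda>x. ennreal (f x)) x = nn_cond_exp M F (\<lambda>x. ennreal (max (f x) 0)) x"
    by (rule nn_cond_exp_cong) (use assms(2) in \<open>auto elim!: AE_mp\<close>)
  have 2: "AE x in M. nn_cond_exp M F (\<lambda>x. ennreal (max (- f x) 0)) x = nn_cond_exp M F (\<lambda>_. 0) x"
    by (rule nn_cond_exp_cong) (use assms(2) in \<open>auto simp: ennreal_neg elim!: AE_mp\<close>)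
  have 3: "AE x in M. 0 = nn_cond_exp M F (\<lambda>_. 0) x"
    by (rule nn_cond_exp_F_meas) auto
  have q0: "AE x in M. q x = 0"
    using 2 3 pq(4) by eventually_elim (use pq(2) in \<open>auto simp: ennreal_eq_0_iff intro: antisym\<close>)
  show "AE x in M. nn_cond_exp M F (\<lambda>x. ennreal (f x)) x = ennreal (g x)"
    using 1 q0 pq(3,5) by eventually_elim auto
  show "AE x in M. 0 \<le> g x"
    using q0 pq(5) by eventually_elim (use pq(1) in auto)
qed

lemma has_cond_exp_subalg:
  assumes [measurable]: "c \<in> borel_measurable F"
  shows "has_cond_exp M F c c"
proof -
  have [measurable]: "c \<in> borel_measurable M" by (rule measurable_from_subalg[OF subalg assms])
  have "has_cond_exp M F (\<lambda>x. max (c x) 0 - max (- c x) 0) (\<lambda>x. max (c x) 0 - max (- c x) 0)"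
    by (rule has_cond_exp_diff_nonneg)
       (use nn_cond_exp_F_meas[of "\<lambda>x. ennreal (max (c x) 0)"] nn_cond_exp_F_meas[of "\<lambda>x. ennreal (max (- c x) 0)"]
         in \<open>auto elim!: AE_mp\<close>)
  moreover have "(\<lambda>x. max (c x) 0 - max (- c x) 0) = c" by (auto simp: fun_eq_iff max_def)
  ultimately show ?thesis by simp
qed

text \<open>The sums of the positive and of the negative parts are in general not the parts of the
  sum, but they form a nonnegative decomposition of it.\<close>

lemma has_cond_exp_add:
  assumes "has_cond_exp M F f g" "has_cond_exp M F f' g'"
  shows "has_cond_exp M F (\<lambda>x. f x + f' x) (\<lambda>x. g x + g' x)"
proof -
  have [measurable]: "f \<in> borel_measurable M" "f' \<in> borel_measurable M"
    using assms by (auto intro: has_cond_exp_measurable)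
  obtain p q where pq: "\<And>x. 0 \<le> p x" "\<And>x. 0 \<le> q x"
    "AE x in M. nn_cond_exp M F (\<lambda>x. ennreal (max (f x) 0)) x = ennreal (p x)"
    "AE x in M. nn_cond_exp M F (\<lambda>x. ennreal (max (- f x) 0)) x = ennreal (q x)"
    "AE x in M. g x = p x - q x"
    by (rule has_cond_exp_parts[OF assms(1)]) blast
  obtain p' q' where pq': "\<And>x. 0 \<le> p' x" "\<And>x. 0 \<le> q' x"
    "AE x in M. nn_cond_exp M F (\<lambda>x. ennreal (max (f' x) 0)) x = ennreal (p' x)"
    "AE x in M. nn_cond_exp M F (\<lambda>x. ennreal (max (- f' x) 0)) x = ennreal (q' x)"
    "AE x in M. g' x = p' x - q' x"
    by (rule has_cond_exp_parts[OF assms(2)]) blast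
  let ?a = "\<lambda>x. max (f x) 0 + max (f' x) 0" and ?b = "\<lambda>x. max (- f x) 0 + max (- f' x) 0"
  have 1: "AE x in M. nn_cond_exp M F (\<lambda>x. ennreal (?a x)) x = ennreal (p x + p' x)"
    using nn_cond_exp_sum[of "\<lambda>x. ennreal (max (f x) 0)" "\<lambda>x. ennreal (max (f' x) 0)"] pq(3) pq'(3)
    by (auto simp: pq pq' elim!: AE_mp)
  have 2: "AE x in M. nn_cond_exp M F (\<lambda>x. ennreal (?b x)) x = ennreal (q x + q' x)"
    using nn_cond_exp_sum[of "\<lambda>x. ennreal (max (- f x) 0)" "\<lambda>x. ennreal (max (- f' x) 0)"] pq(4) pq'(4)
    by (auto simp: pq pq' elim!: AE_mp)
  have "has_cond_exp M F (\<lambda>x. ?a x - ?b x) (\<lambda>x. (p x + p' x) - (q x + q' x))"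
    by (rule has_cond_exp_diff_nonneg[OF _ _ _ _ 1 _ 2]) (auto simp: pq pq')
  moreover have "(\<lambda>x. ?a x - ?b x) = (\<lambda>x. f x + f' x)" by (auto simp: fun_eq_iff max_def)
  ultimately have sum: "has_cond_exp M F (\<lambda>x. f x + f' x) (\<lambda>x. (p x + p' x) - (q x + q' x))" by simp
  have "AE x in M. (p x + p' x) - (q x + q' x) = g x + g' x"
    using pq(5) pq'(5) by eventually_elim simp
  then show ?thesis by (rule has_cond_exp_cong_AE[OF sum])
qed

text \<open>The product is split into the four products of positive and negative parts, where a
  known nonnegative factor can always be taken out. Thus \<open>c\<close> may be unbounded, as
  portfolio weights may be.\<close>

lemma has_cond_exp_mult:
  assumes c [measurable]: "c \<in> borel_measurable F" and "has_cond_exp M F f g"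
  shows "has_cond_exp M F (\<lambda>x. c x * f x) (\<lambda>x. c x * g x)"
proof -
  have [measurable]: "f \<in> borel_measurable M" using assms by (auto intro: has_cond_exp_measurable)
  have [measurable]: "c \<in> borel_measurable M" by (rule measurable_from_subalg[OF subalg c])
  obtain p q where pq: "\<And>x. 0 \<le> p x" "\<And>x. 0 \<le> q x"
    "AE x in M. nn_cond_exp M F (\<lambda>x. ennreal (max (f x) 0)) x = ennreal (p x)"
    "AE x in M. nn_cond_exp M F (\<lambda>x. ennreal (max (- f x) 0)) x = ennreal (q x)"
    "AE x in M. g x = p x - q x"
    by (rule has_cond_exp_parts[OF assms(2)]) blast
  let ?c = "\<lambda>x. max (c x) 0" and ?d = "\<lambda>x. max (- c x) 0"
  let ?f = "\<lambda>x. max (f x) 0" and ?g = "\<lambda>x. max (- f x) 0"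
  let ?a = "\<lambda>x. ?c x * ?f x + ?d x * ?g x" and ?b = "\<lambda>x. ?c x * ?g x + ?d x * ?f x"
  have prod: "AE x in M. ennreal (u x) * nn_cond_exp M F (\<lambda>x. ennreal (v x)) x =
      nn_cond_exp M F (\<lambda>x. ennreal (u x) * ennreal (v x)) x"
    if [measurable]: "u \<in> borel_measurable F" "v \<in> borel_measurable M" for u v :: "'a \<Rightarrow> real"
    by (rule nn_cond_exp_prod) auto
  have 1: "AE x in M. nn_cond_exp M F (\<lambda>x. ennreal (?a x)) x = ennreal (?c x * p x + ?d x * q x)"
    using prod[of ?c ?f] prod[of ?d ?g] pq(3,4)
      nn_cond_exp_sum[of "\<lambda>x. ennreal (?c x) * ennreal (?f x)" "\<lambda>x. ennreal (?d x) * ennreal (?g x)"]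
    by (auto simp: pq ennreal_mult elim!: AE_mp)
  have 2: "AE x in M. nn_cond_exp M F (\<lambda>x. ennreal (?b x)) x = ennreal (?c x * q x + ?d x * p x)"
    using prod[of ?c ?g] prod[of ?d ?f] pq(3,4)
      nn_cond_exp_sum[of "\<lambda>x. ennreal (?c x) * ennreal (?g x)" "\<lambda>x. ennreal (?d x) * ennreal (?f x)"]
    by (auto simp: pq ennreal_mult elim!: AE_mp)
  have "has_cond_exp M F (\<lambda>x. ?a x - ?b x) (\<lambda>x. (?c x * p x + ?d x * q x) - (?c x * q x + ?d x * p x))"
    by (rule has_cond_exp_diff_nonneg[OF _ _ _ _ 1 _ 2]) (auto simp: pq)
  moreover have "(\<lambda>x. ?a x - ?b x) = (\<lambda>x. c x * f x)" by (auto simp: fun_eq_iff max_def)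
  ultimately have prod: "has_cond_exp M F (\<lambda>x. c x * f x)
      (\<lambda>x. (?c x * p x + ?d x * q x) - (?c x * q x + ?d x * p x))" by simp
  have "AE x in M. (?c x * p x + ?d x * q x) - (?c x * q x + ?d x * p x) = c x * g x"
    using pq(5)
  proof eventually_elim
    case (elim x)
    show ?case unfolding elim by (auto simp: algebra_simps max_def)
  qed
  then show ?thesis by (rule has_cond_exp_cong_AE[OF prod])
qed

lemma has_cond_exp_sum:
  assumes "finite I" "\<And>i. i \<in> I \<Longrightarrow> has_cond_exp M F (f i) (g i)"
  shows "has_cond_exp M F (\<lambda>x. \<Sum>i\<in>I. f i x) (\<lambda>x. \<Sum>i\<in>I. g i x)"
  using assms
proof (induction I rule: finite_induct)
  case empty
  then show ?case using has_cond_exp_subalg[of "\<lambda>_. 0"] by simp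
qed (simp add: has_cond_exp_add)

lemma has_cond_exp_diff:
  assumes "has_cond_exp M F f g" "has_cond_exp M F f' g'"
  shows "has_cond_exp M F (\<lambda>x. f x - f' x) (\<lambda>x. g x - g' x)"
  using has_cond_exp_add[OF assms(1) has_cond_exp_mult[OF _ assms(2), of "\<lambda>_. - 1"]] by simp

lemma has_cond_exp_mono:
  assumes "has_cond_exp M F f g" "has_cond_exp M F f' g'" "AE x in M. f x \<le> f' x"
  shows "AE x in M. g x \<le> g' x"
  using has_cond_exp_nonneg(2)[OF has_cond_exp_diff[OF assms(2,1)]] assms(3) by simp

lemma has_cond_exp_unique:
  assumes "has_cond_exp M F f g" "has_cond_exp M F f g'"
  shows "AE x in M. g x = g' x"
  using assms unfolding has_cond_exp_def by (auto elim!: AE_mp)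

text \<open>For a known number \<open>a\<close>, the tangent inequality
  \<open>2 * a * f - a * a \<le> f * f\<close> is conditioned with \<open>a\<close> equal to the
  conditional expectation of \<open>f\<close>.\<close>

lemma cond_exp_square_le:
  assumes f: "has_cond_exp M F f a" and h: "has_cond_exp M F h b"
    and le: "AE x in M. (f x)\<^sup>2 \<le> h x"
  shows "AE x in M. (a x)\<^sup>2 \<le> b x"
proof -
  \<comment> \<open>\<open>a\<close> itself need not be measurable with respect to \<open>F\<close>,
    so the version \<open>real_cond_exp\<close> serves as the known coefficient.\<close>
  let ?a = "real_cond_exp M F f"
  have [measurable]: "f \<in> borel_measurable M" using f by (rule has_cond_exp_measurable)
  have fa: "AE x in M. ?a x = a x" using f by (simp add: has_cond_exp_def)
  have "has_cond_exp M F f ?a" using f by (simp add: has_cond_exp_def)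
  then have "has_cond_exp M F (\<lambda>x. 2 * ?a x * f x - ?a x * ?a x) (\<lambda>x. 2 * ?a x * ?a x - ?a x * ?a x)"
    by (intro has_cond_exp_diff has_cond_exp_mult has_cond_exp_subalg) auto
  moreover have "AE x in M. 2 * ?a x * f x - ?a x * ?a x \<le> h x"
    using le
  proof eventually_elim
    case (elim x)
    have "0 \<le> (f x - ?a x)\<^sup>2" by simp
    then show ?case using elim by (simp add: power2_eq_square algebra_simps)
  qed
  ultimately have "AE x in M. 2 * ?a x * ?a x - ?a x * ?a x \<le> b x"
    by (intro has_cond_exp_mono[OF _ h])
  then show ?thesis using fa by eventually_elim (simp add: power2_eq_square)
qed

section \<open>Conditional expectations of linear and quadratic forms\<close>

lemma has_cond_exp_linear_form:
  fixes Z :: "'a \<Rightarrow> real ^ 'k"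
  assumes "\<And>i. has_cond_exp M F (\<lambda>x. r x * Z x $ i) (\<lambda>x. m x $ i)"
    and y: "y \<in> borel_measurable F"
  shows "has_cond_exp M F (\<lambda>x. r x * (y x \<bullet> Z x)) (\<lambda>x. y x \<bullet> m x)"
proof -
  have [measurable]: "(\<lambda>x. y x $ i) \<in> borel_measurable F" for i
    using y borel_measurable_vec_iff by blast
  have "has_cond_exp M F (\<lambda>x. \<Sum>i\<in>UNIV. y x $ i * (r x * Z x $ i)) (\<lambda>x. \<Sum>i\<in>UNIV. y x $ i * m x $ i)"
    by (intro has_cond_exp_sum has_cond_exp_mult assms) auto
  then show ?thesis by (simp add: inner_vec_def sum_distrib_left mult_ac)
qed

text \<open>The square is expanded into a double sum, from which the products of coordinates of
  \<open>y\<close> are taken out as known factors.\<close>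

lemma has_cond_exp_quadratic_form:
  fixes Z :: "'a \<Rightarrow> real ^ 'k"
  assumes "\<And>i j. has_cond_exp M F (\<lambda>x. \<rho> x * (Z x $ i * Z x $ j)) (\<lambda>x. B x $ i $ j)"
    and y: "y \<in> borel_measurable F"
  shows "has_cond_exp M F (\<lambda>x. \<rho> x * (y x \<bullet> Z x)\<^sup>2) (\<lambda>x. y x \<bullet> (B x *v y x))"
proof -
  have [measurable]: "(\<lambda>x. y x $ i) \<in> borel_measurable F" for i
    using y borel_measurable_vec_iff by blast
  have "has_cond_exp M F (\<lambda>x. \<Sum>i\<in>UNIV. \<Sum>j\<in>UNIV. (y x $ i * y x $ j) * (\<rho> x * (Z x $ i * Z x $ j)))
      (\<lambda>x. \<Sum>i\<in>UNIV. \<Sum>j\<in>UNIV. (y x $ i * y x $ j) * B x $ i $ j)"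
    by (intro has_cond_exp_sum has_cond_exp_mult assms) auto
  moreover have "(\<Sum>i\<in>UNIV. \<Sum>j\<in>UNIV. (y x $ i * y x $ j) * (\<rho> x * (Z x $ i * Z x $ j))) =
      \<rho> x * (y x \<bullet> Z x)\<^sup>2" for x
    by (simp add: inner_vec_def power2_eq_square sum_product sum_distrib_left mult_ac)
  ultimately show ?thesis by (simp add: inner_matrix_vector_sum)
qed

end

context finite_measure_subalgebra
begin

text \<open>A conditional form of dominated convergence in which the bound \<open>h\<close> need
  only have a finite conditional expectation. It is proved on each event where that expectation is
  at most \<open>k\<close>; these events exhaust the space up to a null set.\<close>

lemma nn_cond_exp_INF_eq_0:
  assumes [measurable]: "\<And>n. f n \<in> borel_measurable M" "h \<in> borel_measurable M"
    and le: "\<And>n. AE x in M. f n x \<le> h x" and lim: "AE x in M. (\<lambda>n. f n x) \<longlonglongrightarrow> 0"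
    and fin: "AE x in M. nn_cond_exp M F h x < \<infinity>"
  shows "AE x in M. (INF n. nn_cond_exp M F (f n) x) = 0"
proof -
  let ?q = "\<lambda>x. INF n. nn_cond_exp M F (f n) x"
  have zero: "AE x in M. nn_cond_exp M F h x \<le> of_nat k \<longrightarrow> ?q x = 0" for k :: nat
  proof -
    \<comment> \<open>\<open>I\<close> is the indicator of an event of \<open>F\<close>. It
      localises \<open>h\<close> to a function with finite integral, because the measure is
      finite.\<close>
    define I :: "'a \<Rightarrow> ennreal" where "I = indicator {x \<in> space F. nn_cond_exp M F h x \<le> of_nat k}"
    have I [measurable]: "I \<in> borel_measurable F" unfolding I_def by measurable
    have [measurable]: "I \<in> borel_measurable M" by (rule measurable_from_subalg[OF subalg I])
    have "(\<integral>\<^sup>+x. I x * h x \<partial>M) = (\<integral>\<^sup>+x. I x * nn_cond_exp M F h x \<partial>M)"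
      by (rule nn_cond_exp_intg[symmetric]) auto
    also have "\<dots> \<le> (\<integral>\<^sup>+x. of_nat k \<partial>M)"
      by (intro nn_integral_mono) (auto simp: I_def indicator_def)
    also have "\<dots> < \<infinity>"
      using emeasure_finite[of "space M"] by (auto simp: ennreal_mult_eq_top_iff less_top[symmetric])
    finally have bound: "(\<integral>\<^sup>+x. I x * h x \<partial>M) < \<infinity>" .
    have "(\<lambda>n. \<integral>\<^sup>+x. I x * f n x \<partial>M) \<longlonglongrightarrow> (\<integral>\<^sup>+x. 0 \<partial>M)"
    proof (rule nn_integral_dominated_convergence[OF _ _ _ _ bound])
      show "AE x in M. I x * f n x \<le> I x * h x" for n
        using le[of n] by eventually_elim (auto intro: mult_left_mono)
      show "AE x in M. (\<lambda>n. I x * f n x) \<longlonglongrightarrow> 0"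
        using lim by eventually_elim (auto simp: I_def indicator_def)
    qed auto
    \<comment> \<open>The infimum lies below every member, so its localised integral lies below each
      term of a sequence tending to 0.\<close>
    moreover have "(\<integral>\<^sup>+x. I x * ?q x \<partial>M) \<le> (\<integral>\<^sup>+x. I x * f n x \<partial>M)" for n
    proof -
      have "(\<integral>\<^sup>+x. I x * ?q x \<partial>M) \<le> (\<integral>\<^sup>+x. I x * nn_cond_exp M F (f n) x \<partial>M)"
        by (intro nn_integral_mono mult_left_mono INF_lower) auto
      also have "\<dots> = (\<integral>\<^sup>+x. I x * f n x \<partial>M)"
        by (rule nn_cond_exp_intg) auto
      finally show ?thesis .
    qed
    ultimately have "(\<integral>\<^sup>+x. I x * ?q x \<partial>M) \<le> (\<integral>\<^sup>+x. 0 \<partial>M)"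
      by (intro LIMSEQ_le_const) auto
    then have "(\<integral>\<^sup>+x. I x * ?q x \<partial>M) = 0" by simp
    then have "AE x in M. I x * ?q x = 0"
      by (subst (asm) nn_integral_0_iff_AE) auto
    then show ?thesis
      using AE_space by eventually_elim (use subalg in \<open>auto simp: I_def subalgebra_def\<close>)
  qed
  have "AE x in M. \<forall>k::nat. nn_cond_exp M F h x \<le> of_nat k \<longrightarrow> ?q x = 0"
    unfolding AE_all_countable by (intro allI zero)
  then show ?thesis using fin
  proof eventually_elim
    case (elim x)
    then obtain k :: nat where "nn_cond_exp M F h x < of_nat k"
      using ennreal_Ex_less_of_nat by auto
    then have "nn_cond_exp M F h x \<le> of_nat k" by simp
    then show ?case using elim(1) by blast
  qed
qed

end

section \<open>Conditional moments of the gross return\<close>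

lemma has_cond_exp_entries:
  assumes "\<And>i j. cond_integrable M G (\<lambda>x. Y x $ i $ j)" "AE x in M. cond_exp_mat M G Y x = C x"
  shows "has_cond_exp M G (\<lambda>x. Y x $ i $ j) (\<lambda>x. C x $ i $ j)"
  unfolding has_cond_exp_def
proof
  show "AE x in M. real_cond_exp M G (\<lambda>x. Y x $ i $ j) x = C x $ i $ j"
    using assms(2)
  proof eventually_elim
    case (elim x)
    show ?case unfolding elim[symmetric] by (simp add: cond_exp_mat_def)
  qed
qed (rule assms)

lemma has_cond_exp_components:
  assumes "\<And>i. cond_integrable M G (\<lambda>x. Y x $ i)" "AE x in M. cond_exp_vec M G Y x = c x"
  shows "has_cond_exp M G (\<lambda>x. Y x $ i) (\<lambda>x. c x $ i)"
  unfolding has_cond_exp_def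
proof
  show "AE x in M. real_cond_exp M G (\<lambda>x. Y x $ i) x = c x $ i"
    using assms(2)
  proof eventually_elim
    case (elim x)
    show ?case unfolding elim[symmetric] by (simp add: cond_exp_vec_def)
  qed
qed (rule assms)

lemma borel_measurable_cond_exp_vec [measurable]: "cond_exp_vec M G Y \<in> borel_measurable G"
  unfolding borel_measurable_vec_iff cond_exp_vec_def by simp

lemma borel_measurable_cond_exp_mat [measurable]: "cond_exp_mat M G Y \<in> borel_measurable G"
  unfolding borel_measurable_mat_iff cond_exp_mat_def by simp

context finite_measure_subalgebra
begin

text \<open>Finite conditional second moments dominate the first moments and the mixed products, so
  the covariance may be expanded term by term. This turns mean and covariance into the moments of
  \<open>1 + Y\<close>.\<close>

lemma second_moment_gross_return:
  fixes Y mu :: "'a \<Rightarrow> real ^ 'k"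
  assumes Y: "Y \<in> borel_measurable M"
    and sq: "\<And>i. cond_integrable M F (\<lambda>x. (Y x $ i)\<^sup>2)"
    and mean: "AE x in M. cond_exp_vec M F Y x = mu x"
    and var: "AE x in M. cond_var M F Y x = C x"
  shows "has_cond_exp M F (\<lambda>x. (1 + Y x) $ i) (\<lambda>x. (1 + mu x) $ i)"
    and "has_cond_exp M F (\<lambda>x. (1 + Y x) $ i * (1 + Y x) $ j)
      (\<lambda>x. (C x + outer (1 + mu x) (1 + mu x)) $ i $ j)"
proof -
  have Y_meas [measurable]: "(\<lambda>x. Y x $ i) \<in> borel_measurable M" for i
    using Y borel_measurable_vec_iff by blast
  have prod: "cond_integrable M F (\<lambda>x. Y x $ i * Y x $ j)" for i j
  proof (rule cond_integrable_bound)
    have "has_cond_exp M F (\<lambda>x. (Y x $ i)\<^sup>2 + (Y x $ j)\<^sup>2) (\<lambda>x. real_cond_exp M F (\<lambda>x. (Y x $ i)\<^sup>2) x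
        + real_cond_exp M F (\<lambda>x. (Y x $ j)\<^sup>2) x)"
      by (intro has_cond_exp_add cond_integrable_has_cond_exp sq)
    then show "cond_integrable M F (\<lambda>x. (Y x $ i)\<^sup>2 + (Y x $ j)\<^sup>2)" by (simp add: has_cond_exp_def)
    have "\<bar>a * b\<bar> \<le> a\<^sup>2 + b\<^sup>2" for a b :: real
    proof -
      have "0 \<le> (\<bar>a\<bar> - \<bar>b\<bar>)\<^sup>2" by simp
      then have "2 * \<bar>a * b\<bar> \<le> a\<^sup>2 + b\<^sup>2" by (simp add: power2_diff abs_mult)
      then show ?thesis by linarith
    qed
    then show "AE x in M. \<bar>Y x $ i * Y x $ j\<bar> \<le> (Y x $ i)\<^sup>2 + (Y x $ j)\<^sup>2" by simp
  qed simp
  have single: "cond_integrable M F (\<lambda>x. Y x $ i)" for i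
  proof (rule cond_integrable_bound)
    have "has_cond_exp M F (\<lambda>x. 1 + (Y x $ i)\<^sup>2) (\<lambda>x. 1 + real_cond_exp M F (\<lambda>x. (Y x $ i)\<^sup>2) x)"
      by (intro has_cond_exp_add cond_integrable_has_cond_exp sq has_cond_exp_subalg) auto
    then show "cond_integrable M F (\<lambda>x. 1 + (Y x $ i)\<^sup>2)" by (simp add: has_cond_exp_def)
    have "\<bar>a\<bar> \<le> 1 + a\<^sup>2" for a :: real
    proof -
      have "0 \<le> (\<bar>a\<bar> - 1)\<^sup>2" by simp
      then have "2 * \<bar>a\<bar> \<le> a\<^sup>2 + 1" by (simp add: power2_diff)
      then show ?thesis by linarith
    qed
    then show "AE x in M. \<bar>Y x $ i\<bar> \<le> 1 + (Y x $ i)\<^sup>2" by simp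
  qed simp
  have Y_mu: "has_cond_exp M F (\<lambda>x. Y x $ i) (\<lambda>x. mu x $ i)" for i
    by (rule has_cond_exp_components[OF single mean])
  have "has_cond_exp M F (\<lambda>x. 1 + Y x $ i) (\<lambda>x. 1 + mu x $ i)" for i
    by (intro has_cond_exp_add Y_mu has_cond_exp_subalg) auto
  then show "has_cond_exp M F (\<lambda>x. (1 + Y x) $ i) (\<lambda>x. (1 + mu x) $ i)" by simp
  \<comment> \<open>\<open>e\<close> is the version of the mean used inside \<open>cond_var\<close>.
    It is measurable with respect to \<open>F\<close>, which is not known of \<open>mu\<close> here,
    and so can be taken out as a factor.\<close>
  define e where "e = cond_exp_vec M F Y"
  have [measurable]: "(\<lambda>x. e x $ i) \<in> borel_measurable F" for i
    unfolding e_def cond_exp_vec_def by simp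
  let ?dev = "\<lambda>x. outer (Y x - e x) (Y x - e x)"
  have dev: "cond_integrable M F (\<lambda>x. ?dev x $ i $ j)" for i j
  proof -
    have "has_cond_exp M F
        (\<lambda>x. Y x $ i * Y x $ j - e x $ i * Y x $ j - e x $ j * Y x $ i + e x $ i * e x $ j)
        (\<lambda>x. real_cond_exp M F (\<lambda>x. Y x $ i * Y x $ j) x - e x $ i * mu x $ j - e x $ j * mu x $ i
          + e x $ i * e x $ j)"
      by (intro has_cond_exp_add has_cond_exp_diff has_cond_exp_mult Y_mu has_cond_exp_subalg
          cond_integrable_has_cond_exp prod) auto
    then show ?thesis by (simp add: has_cond_exp_def outer_def algebra_simps)
  qed
  have dev_C: "has_cond_exp M F (\<lambda>x. ?dev x $ i $ j) (\<lambda>x. C x $ i $ j)"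
    using var by (intro has_cond_exp_entries dev) (simp add: cond_var_def e_def)
  \<comment> \<open>The product of gross returns is the product of deviations plus terms that are at
    most linear in \<open>Y\<close> with known coefficients.\<close>
  have sum: "has_cond_exp M F
      (\<lambda>x. ?dev x $ i $ j + e x $ i * Y x $ j + e x $ j * Y x $ i + (1 - e x $ i * e x $ j) + Y x $ i + Y x $ j)
      (\<lambda>x. C x $ i $ j + e x $ i * mu x $ j + e x $ j * mu x $ i + (1 - e x $ i * e x $ j) + mu x $ i + mu x $ j)"
    by (intro has_cond_exp_add has_cond_exp_mult Y_mu has_cond_exp_subalg dev_C) auto
  have "(\<lambda>x. ?dev x $ i $ j + e x $ i * Y x $ j + e x $ j * Y x $ i + (1 - e x $ i * e x $ j) + Y x $ i + Y x $ j)
      = (\<lambda>x. (1 + Y x) $ i * (1 + Y x) $ j)"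
    by (auto simp: outer_def algebra_simps)
  with sum have "has_cond_exp M F (\<lambda>x. (1 + Y x) $ i * (1 + Y x) $ j)
      (\<lambda>x. C x $ i $ j + e x $ i * mu x $ j + e x $ j * mu x $ i + (1 - e x $ i * e x $ j) + mu x $ i + mu x $ j)"
    by simp
  then show "has_cond_exp M F (\<lambda>x. (1 + Y x) $ i * (1 + Y x) $ j)
      (\<lambda>x. (C x + outer (1 + mu x) (1 + mu x)) $ i $ j)"
  proof (rule has_cond_exp_cong_AE)
    show "AE x in M. C x $ i $ j + e x $ i * mu x $ j + e x $ j * mu x $ i + (1 - e x $ i * e x $ j)
        + mu x $ i + mu x $ j = (C x + outer (1 + mu x) (1 + mu x)) $ i $ j"
      using mean by eventually_elim (simp add: e_def[symmetric] outer_def algebra_simps)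
  qed
qed

text \<open>Both functions are nonnegative and have the same integral.\<close>

lemma nn_cond_exp_eq_0_iff:
  assumes [measurable]: "f \<in> borel_measurable M"
  shows "(AE x in M. nn_cond_exp M F f x = 0) \<longleftrightarrow> (AE x in M. f x = 0)"
proof -
  have "(\<integral>\<^sup>+x. nn_cond_exp M F f x \<partial>M) = (\<integral>\<^sup>+x. f x \<partial>M)"
    using nn_cond_exp_intg[of "\<lambda>_. 1" f] by simp
  then show ?thesis
    using nn_integral_0_iff_AE[of "nn_cond_exp M F f" M] nn_integral_0_iff_AE[of f M] by auto
qed

text \<open>Utility is \<open>1 / (2 * \<alpha>)\<close> minus a multiple of the squared distance of
  wealth from \<open>1 / \<alpha>\<close>. It is bounded above, so its positive part has a finite
  conditional expectation and the extended difference is well defined.\<close>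

lemma ereal_cond_exp_utility:
  assumes \<alpha>: "0 < \<alpha>" and V [measurable]: "V \<in> borel_measurable M"
  shows "AE x in M. ereal_cond_exp M F (\<lambda>x. utility \<alpha> (V x)) x =
    ereal (1 / (2 * \<alpha>)) - ereal (\<alpha> / 2) * enn2ereal (nn_cond_exp M F (\<lambda>x. ennreal ((V x - 1 / \<alpha>)\<^sup>2)) x)"
proof -
  let ?c = "1 / (2 * \<alpha>)"
  let ?f = "\<lambda>x. utility \<alpha> (V x)" and ?h = "\<lambda>x. (V x - 1 / \<alpha>)\<^sup>2"
  have [measurable]: "?f \<in> borel_measurable M" unfolding utility_def by measurable
  have u: "?f x = ?c - \<alpha> / 2 * ?h x" for x
    using \<alpha> by (simp add: utility_def power2_eq_square field_simps)
  have eq: "ennreal (?f x) + ennreal (\<alpha> / 2) * ennreal (?h x) = ennreal (- ?f x) + ennreal ?c" for x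
  proof -
    have h: "0 \<le> \<alpha> / 2 * ?h x" using \<alpha> by simp
    have c: "0 \<le> ?c" using \<alpha> by simp
    have "ennreal (?f x) + ennreal (\<alpha> / 2 * ?h x) = ennreal (- ?f x) + ennreal ?c"
      using u[of x] h c
      by (cases "0 \<le> ?f x") (auto simp: ennreal_neg ennreal_plus[symmetric] simp del: ennreal_plus)
    moreover have "ennreal (\<alpha> / 2 * ?h x) = ennreal (\<alpha> / 2) * ennreal (?h x)"
      using \<alpha> by (intro ennreal_mult) auto
    ultimately show ?thesis by (simp only:)
  qed
  have 1: "AE x in M. nn_cond_exp M F (\<lambda>x. ennreal (?f x)) x
      + nn_cond_exp M F (\<lambda>x. ennreal (\<alpha> / 2) * ennreal (?h x)) x
      = nn_cond_exp M F (\<lambda>x. ennreal (?f x) + ennreal (\<alpha> / 2) * ennreal (?h x)) x"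
    by (rule nn_cond_exp_sum) auto
  have 2: "AE x in M. nn_cond_exp M F (\<lambda>x. ennreal (- ?f x)) x + nn_cond_exp M F (\<lambda>x. ennreal ?c) x
      = nn_cond_exp M F (\<lambda>x. ennreal (?f x) + ennreal (\<alpha> / 2) * ennreal (?h x)) x"
    unfolding eq by (rule nn_cond_exp_sum) auto
  have 3: "AE x in M. ennreal (\<alpha> / 2) * nn_cond_exp M F (\<lambda>x. ennreal (?h x)) x =
      nn_cond_exp M F (\<lambda>x. ennreal (\<alpha> / 2) * ennreal (?h x)) x"
    by (rule nn_cond_exp_prod) auto
  have 4: "AE x in M. ennreal ?c = nn_cond_exp M F (\<lambda>x. ennreal ?c) x"
    by (rule nn_cond_exp_F_meas) auto
  have 5: "AE x in M. nn_cond_exp M F (\<lambda>x. ennreal (?f x)) x \<le> nn_cond_exp M F (\<lambda>x. ennreal ?c) x"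
    by (rule nn_cond_exp_mono) (use \<alpha> u in \<open>auto intro!: ennreal_leI\<close>)
  show ?thesis
    using 1 2 3 4 5
  proof eventually_elim
    case (elim x)
    let ?P = "nn_cond_exp M F (\<lambda>x. ennreal (?f x)) x" and ?Q = "nn_cond_exp M F (\<lambda>x. ennreal (- ?f x)) x"
    let ?N = "nn_cond_exp M F (\<lambda>x. ennreal (?h x)) x"
    have bal: "?P + ennreal (\<alpha> / 2) * ?N = ?Q + ennreal ?c" using elim by metis
    have "?P \<le> ennreal ?c" using elim by metis
    then obtain p where p: "?P = ennreal p" "0 \<le> p"
      by (cases ?P) (auto simp: top_unique)
    show ?case
    proof (cases ?N)
      case (real n)
      have "?Q \<noteq> top" using bal p real \<alpha> by (auto simp: ennreal_mult[symmetric] simp flip: ennreal_plus)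
      then obtain q where q: "?Q = ennreal q" "0 \<le> q" by (cases ?Q) auto
      have "p + \<alpha> / 2 * n = q + ?c"
        using bal p q real \<alpha> by (simp flip: ennreal_plus ennreal_mult add: divide_nonneg_nonneg)
      then show ?thesis using p q real by (simp add: ereal_cond_exp_def enn2ereal_ennreal)
    next
      \<comment> \<open>An infinite expected loss must come from the negative part of the utility,
        since the positive part is finite; both sides are then minus infinity.\<close>
      case top
      then have "ennreal (\<alpha> / 2) * ?N = top" using \<alpha> by (simp add: ennreal_mult_top)
      then have "?Q + ennreal ?c = top" using bal by simp
      then have "?Q = top" using ennreal_add_eq_top[of ?Q "ennreal ?c"] by auto
      then show ?thesis using p top \<alpha> by (simp add: ereal_cond_exp_def enn2ereal_ennreal)
    qed
  qed
qed

end

text \<open>Maximising expected utility becomes minimising expected squared loss, also when the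
  losses are infinite.\<close>

lemma quadratic_ereal_le_iff:
  assumes "0 < a"
  shows "ereal c - ereal a * enn2ereal N \<le> ereal c - ereal a * enn2ereal N' \<longleftrightarrow> N' \<le> N"
  using assms by (cases N; cases N') (auto simp: enn2ereal_ennreal top_unique not_le)

subsection \<open>One period\<close>

context finite_measure_subalgebra
begin

text \<open>Splitting according to whether \<open>n * \<rho> < 1\<close> gives \<open>v \<bullet> S v \<le> n (v \<bullet> B v) + |v|\<^sup>2 g\<^sub>n\<close>, where
  \<open>g\<^sub>n\<close> is the conditional expectation of \<open>|Z|\<^sup>2\<close> restricted to the event \<open>n * \<rho> < 1\<close> and hence
  tends to 0: a vector in the kernel of \<open>B\<close> is in the kernel of \<open>S\<close>.\<close>

lemma weighted_second_moment_positive_definite: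
  fixes Z :: "'a \<Rightarrow> real ^ 'k"
  assumes Z: "Z \<in> borel_measurable M" and \<rho> [measurable]: "\<rho> \<in> borel_measurable M"
    and pos: "AE x in M. 0 < \<rho> x"
    and B: "\<And>i j. has_cond_exp M F (\<lambda>x. \<rho> x * (Z x $ i * Z x $ j)) (\<lambda>x. B x $ i $ j)"
    and S: "\<And>i j. has_cond_exp M F (\<lambda>x. Z x $ i * Z x $ j) (\<lambda>x. S x $ i $ j)"
    and pd: "AE x in M. positive_definite (S x)"
  shows "AE x in M. positive_definite (B x)"
proof -
  have [measurable]: "Z \<in> borel_measurable M" by fact
  \<comment> \<open>The factor 1 brings the unweighted moments into the form required by
    \<open>has_cond_exp_quadratic_form\<close>.\<close>
  have S': "has_cond_exp M F (\<lambda>x. 1 * (Z x $ i * Z x $ j)) (\<lambda>x. S x $ i $ j)" for i j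
    using S by simp
  have [measurable]: "(\<lambda>x. Z x $ i) \<in> borel_measurable M" for i
    using Z borel_measurable_vec_iff by blast
  define h where "h = (\<lambda>x. Z x \<bullet> Z x)"
  define f where "f = (\<lambda>(n::nat) x. if real n * \<rho> x < 1 then h x else 0)"
  define g where "g = (\<lambda>n. real_cond_exp M F (f n))"
  have [measurable]: "h \<in> borel_measurable M" "f n \<in> borel_measurable M" for n
    unfolding h_def f_def by measurable
  have h_nonneg: "0 \<le> h x" for x by (simp add: h_def)
  have f_nonneg: "0 \<le> f n x" and f_le: "f n x \<le> h x" for n x
    using h_nonneg[of x] by (auto simp: f_def)
  have "has_cond_exp M F (\<lambda>x. \<Sum>i\<in>UNIV. Z x $ i * Z x $ i) (\<lambda>x. \<Sum>i\<in>UNIV. S x $ i $ i)"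
    by (intro has_cond_exp_sum S) auto
  then have hS: "has_cond_exp M F h (\<lambda>x. \<Sum>i\<in>UNIV. S x $ i $ i)"
    by (simp add: h_def inner_vec_def)
  have fg: "has_cond_exp M F (f n) (g n)" for n
    unfolding g_def
  proof (rule cond_integrable_has_cond_exp, rule cond_integrable_bound[of h])
    show "cond_integrable M F h" using hS by (simp add: has_cond_exp_def)
    show "AE x in M. \<bar>f n x\<bar> \<le> h x" using f_nonneg f_le by simp
  qed auto
  have INF: "AE x in M. (INF n. nn_cond_exp M F (\<lambda>x. ennreal (f n x)) x) = 0"
  proof (rule nn_cond_exp_INF_eq_0[of _ "\<lambda>x. ennreal (h x)"])
    show "AE x in M. ennreal (f n x) \<le> ennreal (h x)" for n
      using f_le by (simp add: ennreal_leI)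
    show "AE x in M. (\<lambda>n. ennreal (f n x)) \<longlonglongrightarrow> 0"
      using pos
    proof eventually_elim
      case (elim x)
      obtain N :: nat where "1 / \<rho> x < real N" using reals_Archimedean2 by blast
      then have "f n x = 0" if "N \<le> n" for n
      proof -
        have "1 / \<rho> x < real n" using \<open>1 / \<rho> x < real N\<close> that by linarith
        then show ?thesis using elim by (simp add: f_def field_simps)
      qed
      then show ?case
        by (intro tendsto_eventually) (auto simp: eventually_sequentially intro!: exI[of _ N])
    qed
    show "AE x in M. nn_cond_exp M F (\<lambda>x. ennreal (h x)) x < \<infinity>"
      using has_cond_exp_nonneg(1)[OF hS] h_nonneg by (auto elim!: AE_mp)
  qed auto
  have "AE x in M. \<forall>n. nn_cond_exp M F (\<lambda>x. ennreal (f n x)) x = ennreal (g n x)"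
    unfolding AE_all_countable using has_cond_exp_nonneg(1)[OF fg] f_nonneg by simp
  with INF have small: "AE x in M. \<forall>e>0. \<exists>n. g n x < e"
  proof eventually_elim
    case (elim x)
    show ?case
    proof (intro allI impI)
      fix e :: real assume e: "0 < e"
      then have "(INF n. nn_cond_exp M F (\<lambda>x. ennreal (f n x)) x) < ennreal e"
        unfolding elim(1) by simp
      then obtain n where "ennreal (g n x) < ennreal e"
        unfolding INF_less_iff elim(2)[rule_format] by blast
      then have "g n x < e" by (meson ennreal_leI not_le)
      then show "\<exists>n. g n x < e" by blast
    qed
  qed
  obtain D :: "(real ^ 'k) set" where D: "countable D"
    "\<And>P. closed {v. P v} \<Longrightarrow> (\<And>v. v \<in> D \<Longrightarrow> P v) \<Longrightarrow> (\<forall>v. P v)"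
    by (rule countable_dense_closedE) blast
  have "AE x in M. v \<bullet> (S x *v v) \<le> real n * (v \<bullet> (B x *v v)) + (v \<bullet> v) * g n x" for v n
  proof (rule has_cond_exp_mono)
    show "has_cond_exp M F (\<lambda>x. 1 * (v \<bullet> Z x)\<^sup>2) (\<lambda>x. v \<bullet> (S x *v v))"
      by (rule has_cond_exp_quadratic_form[OF S']) auto
    show "has_cond_exp M F (\<lambda>x. real n * (\<rho> x * (v \<bullet> Z x)\<^sup>2) + (v \<bullet> v) * f n x)
        (\<lambda>x. real n * (v \<bullet> (B x *v v)) + (v \<bullet> v) * g n x)"
      by (intro has_cond_exp_add has_cond_exp_mult has_cond_exp_quadratic_form B fg) auto
    show "AE x in M. 1 * (v \<bullet> Z x)\<^sup>2 \<le> real n * (\<rho> x * (v \<bullet> Z x)\<^sup>2) + v \<bullet> v * f n x"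
      using pos
    proof eventually_elim
      case (elim x)
      show ?case
      proof (cases "real n * \<rho> x < 1")
        case True
        have "(v \<bullet> Z x)\<^sup>2 \<le> (v \<bullet> v) * (Z x \<bullet> Z x)" by (rule Cauchy_Schwarz_ineq)
        moreover have "0 \<le> real n * (\<rho> x * (v \<bullet> Z x)\<^sup>2)" using elim by simp
        ultimately show ?thesis using True by (simp add: f_def h_def)
      next
        case False
        then have "1 * (v \<bullet> Z x)\<^sup>2 \<le> real n * \<rho> x * (v \<bullet> Z x)\<^sup>2" by (intro mult_right_mono) auto
        then show ?thesis using False by (simp add: f_def mult.assoc)
      qed
    qed
  qed
  then have "AE x in M. \<forall>n. \<forall>v\<in>D. v \<bullet> (S x *v v) \<le> real n * (v \<bullet> (B x *v v)) + (v \<bullet> v) * g n x"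
    unfolding AE_all_countable AE_ball_countable[OF D(1)] by blast
  \<comment> \<open>Both sides are continuous in \<open>v\<close>, so the null set found for the
    countable set \<open>D\<close> serves all vectors at once.\<close>
  then have le: "AE x in M. \<forall>n v. v \<bullet> (S x *v v) \<le> real n * (v \<bullet> (B x *v v)) + (v \<bullet> v) * g n x"
  proof eventually_elim
    case (elim x)
    show ?case
    proof (rule allI, rule D(2))
      fix n
      show "closed {v. v \<bullet> (S x *v v) \<le> real n * (v \<bullet> (B x *v v)) + (v \<bullet> v) * g n x}"
        by (intro closed_Collect_le continuous_on_add continuous_on_mult continuous_on_const
            continuous_on_inner continuous_on_id matrix_vector_mult_linear_continuous_on)
    qed (use elim in blast)
  qed
  have "AE x in M. 0 \<le> v \<bullet> (B x *v v)" for v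
  proof (rule has_cond_exp_nonneg(2)[OF has_cond_exp_quadratic_form[OF B]])
    show "AE x in M. 0 \<le> \<rho> x * (v \<bullet> Z x)\<^sup>2" using pos by eventually_elim simp
  qed simp
  then have "AE x in M. \<forall>v\<in>D. 0 \<le> v \<bullet> (B x *v v)"
    unfolding AE_ball_countable[OF D(1)] by blast
  then have psd: "AE x in M. \<forall>v. 0 \<le> v \<bullet> (B x *v v)"
  proof eventually_elim
    case (elim x)
    show ?case
    proof (rule D(2))
      show "closed {v. 0 \<le> v \<bullet> (B x *v v)}"
        by (intro closed_Collect_le continuous_on_const
            continuous_on_inner continuous_on_id matrix_vector_mult_linear_continuous_on)
    qed (use elim in blast)
  qed
  have "AE x in M. B x $ i $ j = B x $ j $ i" for i j
    using has_cond_exp_unique[OF B[of i j]] B[of j i] by (simp add: mult.commute)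
  then have sym: "AE x in M. \<forall>i j. B x $ i $ j = B x $ j $ i"
    by (simp add: AE_all_countable)
  show ?thesis
    using pd le psd sym small
  proof eventually_elim
    case (elim x)
    \<comment> \<open>For nonzero \<open>v\<close>, some \<open>n\<close> makes the remainder
      \<open>(v \<bullet> v) * g n x\<close> smaller than \<open>v \<bullet> (S x *v v)\<close>. If
      the form of \<open>B x\<close> were not positive at \<open>v\<close>, the splitting inequality
      would fail for this \<open>n\<close>.\<close>
    have "v = 0" if v: "v \<bullet> (B x *v v) \<le> 0" for v
    proof (rule ccontr)
      assume nz: "v \<noteq> 0"
      then have pos: "0 < v \<bullet> (S x *v v)" "0 < v \<bullet> v" using elim(1) by (auto simp: positive_definite_def)
      then obtain n where "g n x < v \<bullet> (S x *v v) / (v \<bullet> v)"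
        using elim(5) by (meson divide_pos_pos)
      then have "(v \<bullet> v) * g n x < v \<bullet> (S x *v v)" using pos by (simp add: field_simps)
      moreover have "real n * (v \<bullet> (B x *v v)) \<le> 0" using v by (simp add: mult_nonneg_nonpos)
      ultimately show False using elim(2)[rule_format, of v n] by linarith
    qed
    moreover have "transpose (B x) = B x" using elim(4) by (simp add: transpose_def vec_eq_iff)
    ultimately show ?case by (auto simp: positive_definite_def not_le[symmetric])
  qed
qed

text \<open>The hypotheses of this context describe one step of the backward recursion: \<open>Z\<close> is the gross
  return of the period, \<open>\<rho>\<close> and \<open>r\<close> are the coefficients carried back from the next period.\<close>

context
  fixes Z :: "'a \<Rightarrow> real ^ 'k" and \<rho> r :: "'a \<Rightarrow> real" and m :: "'a \<Rightarrow> real ^ 'k"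
    and B S :: "'a \<Rightarrow> real ^ 'k ^ 'k"
  assumes Z: "Z \<in> borel_measurable M" and \<rho>: "\<rho> \<in> borel_measurable M"
    and r: "r \<in> borel_measurable M"
    and pos: "AE x in M. 0 < \<rho> x" and r_le: "AE x in M. (r x)\<^sup>2 \<le> \<rho> x"
    and B: "\<And>i j. has_cond_exp M F (\<lambda>x. \<rho> x * (Z x $ i * Z x $ j)) (\<lambda>x. B x $ i $ j)"
    and m: "\<And>i. has_cond_exp M F (\<lambda>x. r x * Z x $ i) (\<lambda>x. m x $ i)"
    and S: "\<And>i j. has_cond_exp M F (\<lambda>x. Z x $ i * Z x $ j) (\<lambda>x. S x $ i $ j)"
    and pd: "AE x in M. positive_definite (S x)"
    and B_meas: "B \<in> borel_measurable F" and m_meas: "m \<in> borel_measurable F"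
begin

lemma step_positive_definite: "AE x in M. positive_definite (B x)"
  by (rule weighted_second_moment_positive_definite[OF Z \<rho> pos B S pd])

text \<open>This is the conditional Cauchy-Schwarz inequality for the amounts
  \<open>y = matrix_inv B *v m\<close>, which are known at the start of the period. For this choice
  \<open>y \<bullet> m\<close> and \<open>y \<bullet> (B *v y)\<close> are the same number.\<close>

lemma step_inverse_quadratic_le_1: "AE x in M. m x \<bullet> (matrix_inv (B x) *v m x) \<le> 1"
proof -
  have [measurable]: "B \<in> borel_measurable F" "m \<in> borel_measurable F" by (rule B_meas m_meas)+
  define y where "y = (\<lambda>x. matrix_inv (B x) *v m x)"
  have y: "y \<in> borel_measurable F" unfolding y_def by measurable
  have "AE x in M. (y x \<bullet> m x)\<^sup>2 \<le> y x \<bullet> (B x *v y x)"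
  proof (rule cond_exp_square_le)
    show "has_cond_exp M F (\<lambda>x. r x * (y x \<bullet> Z x)) (\<lambda>x. y x \<bullet> m x)"
      by (rule has_cond_exp_linear_form[OF m y])
    show "has_cond_exp M F (\<lambda>x. \<rho> x * (y x \<bullet> Z x)\<^sup>2) (\<lambda>x. y x \<bullet> (B x *v y x))"
      by (rule has_cond_exp_quadratic_form[OF B y])
    show "AE x in M. (r x * (y x \<bullet> Z x))\<^sup>2 \<le> \<rho> x * (y x \<bullet> Z x)\<^sup>2"
      using r_le by eventually_elim (simp add: power_mult_distrib mult_right_mono)
  qed
  then show ?thesis
    using step_positive_definite
    by eventually_elim (rule pd_inverse_quadratic_le_1, auto simp: y_def)
qed

text \<open>This carries the hypothesis \<open>r_le\<close> back by one period, to the coefficients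
  of the preceding step.\<close>

lemma step_R_of_square_le: "AE x in M. (R_of (B x) (m x))\<^sup>2 \<le> V_of (B x)"
  using step_positive_definite step_inverse_quadratic_le_1
proof eventually_elim
  case (elim x)
  have "(R_of (B x) (m x))\<^sup>2 \<le> V_of (B x) * (m x \<bullet> (matrix_inv (B x) *v m x))"
    by (rule R_of_square_le[OF elim(1)])
  also have "\<dots> \<le> V_of (B x) * 1"
    using V_of_pos[OF elim(1)] elim(2) by (intro mult_left_mono) auto
  finally show ?case by simp
qed

text \<open>The loss exceeds the square of \<open>r x * w - b\<close> by a nonnegative multiple of
  the squared wealth. The null set is independent of \<open>w\<close>, so random wealth may be
  inserted.\<close>

lemma step_loss_nonneg: "AE x in M. \<forall>w. 0 \<le> \<rho> x * w\<^sup>2 - 2 * b * r x * w + b\<^sup>2"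
  using r_le
proof eventually_elim
  case (elim x)
  show ?case
  proof
    fix w
    have "0 \<le> (r x * w - b)\<^sup>2" by simp
    also have "\<dots> = (r x)\<^sup>2 * w\<^sup>2 - 2 * b * r x * w + b\<^sup>2" by (simp add: power2_eq_square algebra_simps)
    also have "\<dots> \<le> \<rho> x * w\<^sup>2 - 2 * b * r x * w + b\<^sup>2" using elim by (simp add: mult_right_mono)
    finally show "0 \<le> \<rho> x * w\<^sup>2 - 2 * b * r x * w + b\<^sup>2" .
  qed
qed

text \<open>Given \<open>F\<close>, the expected loss is a quadratic function of the known vector
  \<open>y\<close>, to which \<open>complete_square\<close> applies. The term with
  \<open>Q_of\<close> stands on the left so that all four terms are nonnegative and no subtraction
  in \<open>ennreal\<close> occurs.\<close>

lemma step_loss: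
  assumes y: "y \<in> borel_measurable F" and sum: "AE x in M. y x \<bullet> 1 = w x"
  shows "AE x in M. nn_cond_exp M F (\<lambda>x. ennreal (\<rho> x * (y x \<bullet> Z x)\<^sup>2 - 2 * b * r x * (y x \<bullet> Z x) + b\<^sup>2)) x
      + ennreal (b\<^sup>2 * (m x \<bullet> (Q_of (B x) *v m x)))
    = ennreal (V_of (B x) * (w x)\<^sup>2 - 2 * b * R_of (B x) (m x) * w x + b\<^sup>2)
      + ennreal ((y x - opt_amount b (B x) (m x) (w x)) \<bullet> (B x *v (y x - opt_amount b (B x) (m x) (w x))))"
proof -
  let ?f = "\<lambda>x. \<rho> x * (y x \<bullet> Z x)\<^sup>2 - 2 * b * r x * (y x \<bullet> Z x) + b\<^sup>2"
  let ?g = "\<lambda>x. y x \<bullet> (B x *v y x) - 2 * b * (y x \<bullet> m x) + b\<^sup>2"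
  have "has_cond_exp M F (\<lambda>x. \<rho> x * (y x \<bullet> Z x)\<^sup>2 - 2 * b * (r x * (y x \<bullet> Z x)) + b\<^sup>2) ?g"
    by (intro has_cond_exp_add has_cond_exp_diff has_cond_exp_mult has_cond_exp_subalg
        has_cond_exp_quadratic_form has_cond_exp_linear_form B m y) auto
  then have fg: "has_cond_exp M F ?f ?g" by (simp add: mult.assoc)
  have "AE x in M. 0 \<le> ?f x" using step_loss_nonneg[of b] by (auto elim!: AE_mp)
  note fg = has_cond_exp_nonneg[OF fg this]
  show ?thesis
    using fg step_positive_definite step_R_of_square_le sum
  proof eventually_elim
    case (elim x)
    have e: "0 \<le> b\<^sup>2 * (m x \<bullet> (Q_of (B x) *v m x))"
      using inner_Q_of_nonneg[OF elim(3)] by simp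
    let ?z = "y x - opt_amount b (B x) (m x) (w x)"
    have gap: "0 \<le> ?z \<bullet> (B x *v ?z)" by (rule pd_quadratic_nonneg[OF elim(3)])
    \<comment> \<open>Nonnegativity of the loss with the new coefficients is needed to split the
      real sum into a sum in \<open>ennreal\<close>.\<close>
    have "0 \<le> (R_of (B x) (m x) * w x - b)\<^sup>2" by simp
    also have "\<dots> = (R_of (B x) (m x))\<^sup>2 * (w x)\<^sup>2 - 2 * b * R_of (B x) (m x) * w x + b\<^sup>2"
      by (simp add: power2_eq_square algebra_simps)
    also have "\<dots> \<le> V_of (B x) * (w x)\<^sup>2 - 2 * b * R_of (B x) (m x) * w x + b\<^sup>2"
      using elim(4) by (simp add: mult_right_mono)
    finally have loss: "0 \<le> V_of (B x) * (w x)\<^sup>2 - 2 * b * R_of (B x) (m x) * w x + b\<^sup>2" .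
    have "?g x + b\<^sup>2 * (m x \<bullet> (Q_of (B x) *v m x)) =
        (V_of (B x) * (w x)\<^sup>2 - 2 * b * R_of (B x) (m x) * w x + b\<^sup>2) + ?z \<bullet> (B x *v ?z)"
      using complete_square[OF elim(3) elim(5), of b "m x"] by linarith
    then show ?case
      unfolding elim(1) using elim(2) e gap loss by (metis ennreal_plus)
  qed
qed

text \<open>This uniform bound will make the strategy-independent constant finite and hence
  cancellable.\<close>

lemma step_constant_le: "AE x in M. b\<^sup>2 * (m x \<bullet> (Q_of (B x) *v m x)) \<le> b\<^sup>2"
  using step_positive_definite step_inverse_quadratic_le_1
proof eventually_elim
  case (elim x)
  have "m x \<bullet> (Q_of (B x) *v m x) \<le> 1" using inner_Q_of_le[OF elim(1), of "m x"] elim(2) by linarith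
  then show ?case using mult_left_mono[of "m x \<bullet> (Q_of (B x) *v m x)" 1 "b\<^sup>2"] by simp
qed

end

end

subsection \<open>Many periods\<close>

lemma wealth_start: "u \<le> s \<Longrightarrow> wealth X s W w u = W"
  by (cases u) auto

lemma feedback_wealth_start: "u \<le> s \<Longrightarrow> feedback_wealth X s W p u = W"
  by (cases u) auto

lemma wealth_feedback_strategy:
  "wealth X s W (feedback_strategy X s W p) u = feedback_wealth X s W p u"
  by (induction u) (auto simp: feedback_strategy_def fun_eq_iff)

lemma scaled_opt_weights:
  assumes "x \<noteq> 0" "\<alpha> \<noteq> 0"
  shows "x *\<^sub>R opt_weights M F X mu Cov \<alpha> T u x \<omega> =
    opt_amount (1 / \<alpha>) (A_mat M F X mu Cov T (u + 1) \<omega>) (mu_star M F X mu Cov T (u + 1) \<omega>) x"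
  using assms by (simp add: opt_weights_def opt_amount_def V_of_def Let_def scaleR_add_right)

lemma sum_opt_weights:
  assumes "positive_definite (A_mat M F X mu Cov T (u + 1) \<omega>)"
  shows "opt_weights M F X mu Cov \<alpha> T u x \<omega> \<bullet> 1 = 1"
  using pd_inverse_sum_pos[OF assms] sum_Q_of[OF assms]
  by (simp add: opt_weights_def Let_def inner_add_right inner_commute[of _ 1])

section \<open>The backward recursion for the coefficients of the loss\<close>

locale portfolio_market = prob_space M for M :: "'a measure" +
  fixes F :: "nat \<Rightarrow> 'a measure" and X mu :: "nat \<Rightarrow> 'a \<Rightarrow> real ^ 'k"
    and Cov :: "nat \<Rightarrow> 'a \<Rightarrow> real ^ 'k ^ 'k" and T :: nat
  assumes filtration: "filtration (space M) F" and subalg: "\<And>\<tau>. subalgebra M (F \<tau>)"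
    and X_meas: "\<And>\<tau>. \<tau> \<in> {0..T} \<Longrightarrow> X \<tau> \<in> borel_measurable (F \<tau>)"
    and X_sq: "\<And>\<tau> i. \<tau> \<in> {1..T} \<Longrightarrow> cond_integrable M (F (\<tau> - 1)) (\<lambda>\<omega>. (X \<tau> \<omega> $ i)\<^sup>2)"
    and mu_meas: "\<And>\<tau>. \<tau> \<in> {1..T} \<Longrightarrow> mu \<tau> \<in> borel_measurable (F (\<tau> - 1))"
    and mu_eq: "\<And>\<tau>. \<tau> \<in> {1..T} \<Longrightarrow> AE \<omega> in M. cond_exp_vec M (F (\<tau> - 1)) (X \<tau>) \<omega> = mu \<tau> \<omega>"
    and Cov_meas: "\<And>\<tau>. \<tau> \<in> {1..T} \<Longrightarrow> Cov \<tau> \<in> borel_measurable (F (\<tau> - 1))"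
    and Cov_eq: "\<And>\<tau>. \<tau> \<in> {1..T} \<Longrightarrow> AE \<omega> in M. cond_var M (F (\<tau> - 1)) (X \<tau>) \<omega> = Cov \<tau> \<omega>"
    and Cov_pd: "\<And>\<tau>. \<tau> \<in> {1..T} \<Longrightarrow> AE \<omega> in M. positive_definite (Cov \<tau> \<omega>)"
    and weighted_integrable: "\<And>t i j. t \<in> {2..T} \<Longrightarrow> cond_integrable M (F (T - t))
           (\<lambda>\<omega>. V_coef M F X mu Cov T (T - t + 2) \<omega> *
              ((1 + X (T - t + 1) \<omega>) $ i * (1 + X (T - t + 1) \<omega>) $ j))"
begin

abbreviation "A \<equiv> A_mat M F X mu Cov T"
abbreviation "m \<equiv> mu_star M F X mu Cov T"

text \<open>The coefficients of the quadratic loss at time \<open>u\<close>, indexed by time rather than by period: for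
  \<open>u < T\<close> these are the scalars \<open>V\<close> and \<open>R\<close> of period \<open>u + 1\<close>.\<close>

definition rho :: "nat \<Rightarrow> 'a \<Rightarrow> real" where
  "rho u \<omega> = (if u < T then V_of (A (Suc u) \<omega>) else 1)"

definition r :: "nat \<Rightarrow> 'a \<Rightarrow> real" where
  "r u \<omega> = (if u < T then R_of (A (Suc u) \<omega>) (m (Suc u) \<omega>) else 1)"

definition loss :: "real \<Rightarrow> nat \<Rightarrow> real \<Rightarrow> 'a \<Rightarrow> real" where
  "loss b u x \<omega> = rho u \<omega> * x\<^sup>2 - 2 * b * r u \<omega> * x + b\<^sup>2"

text \<open>The amount by which the least conditional expectation of the next loss falls below
  \<open>loss b u\<close>. It involves neither wealth nor strategy.\<close>

definition hedge :: "real \<Rightarrow> nat \<Rightarrow> 'a \<Rightarrow> real" where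
  "hedge b u \<omega> = b\<^sup>2 * (m (Suc u) \<omega> \<bullet> (Q_of (A (Suc u) \<omega>) *v m (Suc u) \<omega>))"

text \<open>The deviation is measured in amounts rather than weights, so it stays meaningful at
  wealth 0. Its quadratic form \<open>gap\<close> is the excess expected loss caused by the
  deviation.\<close>

definition gap_vec :: "real \<Rightarrow> nat \<Rightarrow> real \<Rightarrow> real ^ 'k \<Rightarrow> 'a \<Rightarrow> real ^ 'k" where
  "gap_vec b u x v \<omega> = x *\<^sub>R v - opt_amount b (A (Suc u) \<omega>) (m (Suc u) \<omega>) x"

definition gap :: "real \<Rightarrow> nat \<Rightarrow> real \<Rightarrow> real ^ 'k \<Rightarrow> 'a \<Rightarrow> real" where
  "gap b u x v \<omega> = gap_vec b u x v \<omega> \<bullet> (A (Suc u) \<omega> *v gap_vec b u x v \<omega>)"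

lemma finite_subalgebra: "finite_measure_subalgebra M (F u)"
  by unfold_locales (rule subalg)

lemma measurable_M: "f \<in> measurable (F u) N \<Longrightarrow> f \<in> measurable M N"
  by (rule measurable_from_subalg[OF subalg])

lemma subalgebra_mono: "u \<le> v \<Longrightarrow> subalgebra (F v) (F u)"
  using filtration by (simp add: subalgebra_def filtration.space_F filtration.sets_F_mono)

lemma measurable_mono: "u \<le> v \<Longrightarrow> f \<in> measurable (F u) N \<Longrightarrow> f \<in> measurable (F v) N"
  by (rule measurable_from_subalg[OF subalgebra_mono])

lemma gross_return_meas: "u < T \<Longrightarrow> (\<lambda>\<omega>. 1 + X (Suc u) \<omega>) \<in> borel_measurable (F (Suc u))"
  using X_meas[of "Suc u"] by simp

lemma A_meas: "u < T \<Longrightarrow> A (Suc u) \<in> borel_measurable (F u)"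
proof (cases "Suc u < T")
  case True
  then show ?thesis by (subst A_mat.simps) simp
next
  case False
  assume "u < T"
  then have T: "Suc u = T" using False by simp
  have [measurable]: "Cov T \<in> borel_measurable (F u)" "mu T \<in> borel_measurable (F u)"
    using Cov_meas[of T] mu_meas[of T] T by auto
  have "A (Suc u) = (\<lambda>\<omega>. Cov T \<omega> + outer (1 + mu T \<omega>) (1 + mu T \<omega>))"
    by (subst A_mat.simps) (simp add: T)
  then show ?thesis by simp
qed

lemma m_meas: "u < T \<Longrightarrow> m (Suc u) \<in> borel_measurable (F u)"
proof (cases "Suc u < T")
  case True
  then show ?thesis by (subst mu_star.simps) simp
next
  case False
  assume "u < T"
  then have T: "Suc u = T" using False by simp
  have [measurable]: "mu T \<in> borel_measurable (F u)"
    using mu_meas[of T] T by auto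
  have "m (Suc u) = (\<lambda>\<omega>. 1 + mu T \<omega>)"
    by (subst mu_star.simps) (simp add: T)
  then show ?thesis by simp
qed

lemma rho_meas: "u \<le> T \<Longrightarrow> rho u \<in> borel_measurable (F u)"
proof (cases "u < T")
  case True
  then have [measurable]: "A (Suc u) \<in> borel_measurable (F u)" by (rule A_meas)
  show ?thesis using True by (simp add: rho_def[abs_def])
qed (simp add: rho_def[abs_def])

lemma r_meas: "u \<le> T \<Longrightarrow> r u \<in> borel_measurable (F u)"
proof (cases "u < T")
  case True
  then have [measurable]: "A (Suc u) \<in> borel_measurable (F u)" "m (Suc u) \<in> borel_measurable (F u)"
    by (rule A_meas m_meas)+
  show ?thesis using True by (simp add: r_def[abs_def])
qed (simp add: r_def[abs_def])

lemma gross_return_moments: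
  assumes "u < T"
  shows "has_cond_exp M (F u) (\<lambda>\<omega>. (1 + X (Suc u) \<omega>) $ i) (\<lambda>\<omega>. (1 + mu (Suc u) \<omega>) $ i)"
    and "has_cond_exp M (F u) (\<lambda>\<omega>. (1 + X (Suc u) \<omega>) $ i * (1 + X (Suc u) \<omega>) $ j)
      (\<lambda>\<omega>. (Cov (Suc u) \<omega> + outer (1 + mu (Suc u) \<omega>) (1 + mu (Suc u) \<omega>)) $ i $ j)"
proof -
  interpret finite_measure_subalgebra M "F u" by (rule finite_subalgebra)
  have X: "X (Suc u) \<in> borel_measurable M"
    using X_meas[of "Suc u"] assms by (auto intro: measurable_M)
  note moments = second_moment_gross_return[OF X]
  show "has_cond_exp M (F u) (\<lambda>\<omega>. (1 + X (Suc u) \<omega>) $ i) (\<lambda>\<omega>. (1 + mu (Suc u) \<omega>) $ i)"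
    using X_sq[of "Suc u"] mu_eq[of "Suc u"] Cov_eq[of "Suc u"] assms by (intro moments(1)) auto
  show "has_cond_exp M (F u) (\<lambda>\<omega>. (1 + X (Suc u) \<omega>) $ i * (1 + X (Suc u) \<omega>) $ j)
      (\<lambda>\<omega>. (Cov (Suc u) \<omega> + outer (1 + mu (Suc u) \<omega>) (1 + mu (Suc u) \<omega>)) $ i $ j)"
    using X_sq[of "Suc u"] mu_eq[of "Suc u"] Cov_eq[of "Suc u"] assms by (intro moments(2)) auto
qed

lemma gross_return_pd:
  "u < T \<Longrightarrow> AE \<omega> in M. positive_definite (Cov (Suc u) \<omega> + outer (1 + mu (Suc u) \<omega>) (1 + mu (Suc u) \<omega>))"
  using Cov_pd[of "Suc u"] by (auto intro: positive_definite_add_outer)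

text \<open>Since \<open>rho T\<close> is 1, the two cases in the definition of \<open>A_mat\<close>
  have one common description: the second moment of the gross return weighted by the next
  \<open>rho\<close>.\<close>

lemma A_cond_exp:
  assumes u: "u < T"
  shows "has_cond_exp M (F u) (\<lambda>\<omega>. rho (Suc u) \<omega> * ((1 + X (Suc u) \<omega>) $ i * (1 + X (Suc u) \<omega>) $ j))
    (\<lambda>\<omega>. A (Suc u) \<omega> $ i $ j)"
proof (cases "Suc u < T")
  case True
  \<comment> \<open>The integrability hypothesis counts from the end: here \<open>T - t\<close> is
    \<open>u\<close>, and period \<open>T - t + 2\<close> carries the coefficient
    \<open>rho (Suc u)\<close>.\<close>
  define t where "t = T - u"
  have t: "t \<in> {2..T}" "T - t = u" using True by (auto simp: t_def)
  have "cond_integrable M (F u)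
      (\<lambda>\<omega>. rho (Suc u) \<omega> * ((1 + X (Suc u) \<omega>) $ i * (1 + X (Suc u) \<omega>) $ j))"
    using weighted_integrable[OF t(1), of i j] True unfolding t(2) by (simp add: V_coef_def rho_def)
  note int = cond_integrable_has_cond_exp[OF this]
  have "A (Suc u) = cond_exp_mat M (F u)
      (\<lambda>\<omega>. V_of (A (Suc u + 1) \<omega>) *\<^sub>R outer (1 + X (Suc u) \<omega>) (1 + X (Suc u) \<omega>))"
    by (subst A_mat.simps) (simp add: True)
  then have "A (Suc u) \<omega> $ i $ j = real_cond_exp M (F u)
      (\<lambda>\<omega>. rho (Suc u) \<omega> * ((1 + X (Suc u) \<omega>) $ i * (1 + X (Suc u) \<omega>) $ j)) \<omega>" for \<omega>
    using True by (simp add: cond_exp_mat_def outer_def rho_def)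
  with int show ?thesis by simp
next
  case False
  then have T: "Suc u = T" using u by simp
  have "A (Suc u) = (\<lambda>\<omega>. Cov T \<omega> + outer (1 + mu T \<omega>) (1 + mu T \<omega>))"
    by (subst A_mat.simps) (simp add: T)
  then show ?thesis using gross_return_moments(2)[OF u, of i j] by (simp add: T rho_def)
qed

text \<open>Before the last period, conditional integrability follows from \<open>r_le\<close>: the
  weighted return is at most 1 plus its square, and that square is dominated by the integrand of a
  diagonal entry of \<open>A\<close>.\<close>

lemma m_cond_exp:
  assumes u: "u < T" and r_le: "AE \<omega> in M. (r (Suc u) \<omega>)\<^sup>2 \<le> rho (Suc u) \<omega>"
  shows "has_cond_exp M (F u) (\<lambda>\<omega>. r (Suc u) \<omega> * (1 + X (Suc u) \<omega>) $ i) (\<lambda>\<omega>. m (Suc u) \<omega> $ i)"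
proof (cases "Suc u < T")
  case True
  interpret finite_measure_subalgebra M "F u" by (rule finite_subalgebra)
  let ?z = "\<lambda>\<omega>. (1 + X (Suc u) \<omega>) $ i"
  have [measurable]: "?z \<in> borel_measurable M"
    using measurable_M[OF gross_return_meas[OF u]] unfolding borel_measurable_vec_iff by simp
  have [measurable]: "r (Suc u) \<in> borel_measurable M" using r_meas[of "Suc u"] u by (auto intro: measurable_M)
  have "cond_integrable M (F u) (\<lambda>\<omega>. r (Suc u) \<omega> * ?z \<omega>)"
  proof (rule cond_integrable_bound)
    have "has_cond_exp M (F u) (\<lambda>\<omega>. 1 + rho (Suc u) \<omega> * (?z \<omega> * ?z \<omega>)) (\<lambda>\<omega>. 1 + A (Suc u) \<omega> $ i $ i)"
      by (intro has_cond_exp_add A_cond_exp u has_cond_exp_subalg) auto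
    then show "cond_integrable M (F u) (\<lambda>\<omega>. 1 + rho (Suc u) \<omega> * (?z \<omega> * ?z \<omega>))"
      by (simp add: has_cond_exp_def)
    show "AE \<omega> in M. \<bar>r (Suc u) \<omega> * ?z \<omega>\<bar> \<le> 1 + rho (Suc u) \<omega> * (?z \<omega> * ?z \<omega>)"
      using r_le
    proof eventually_elim
      case (elim \<omega>)
      have "0 \<le> (\<bar>r (Suc u) \<omega> * ?z \<omega>\<bar> - 1)\<^sup>2" by simp
      then have "2 * \<bar>r (Suc u) \<omega> * ?z \<omega>\<bar> \<le> (r (Suc u) \<omega> * ?z \<omega>)\<^sup>2 + 1" by (simp add: power2_diff)
      moreover have "(r (Suc u) \<omega> * ?z \<omega>)\<^sup>2 \<le> rho (Suc u) \<omega> * (?z \<omega>)\<^sup>2"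
        unfolding power_mult_distrib using elim by (rule mult_right_mono) simp
      ultimately show ?case unfolding power2_eq_square[of "?z \<omega>"] by linarith
    qed
  qed measurable
  note int = cond_integrable_has_cond_exp[OF this]
  have "m (Suc u) = cond_exp_vec M (F u)
      (\<lambda>\<omega>. R_of (A (Suc u + 1) \<omega>) (m (Suc u + 1) \<omega>) *\<^sub>R (1 + X (Suc u) \<omega>))"
    by (subst mu_star.simps) (simp add: True)
  then have "m (Suc u) \<omega> $ i = real_cond_exp M (F u) (\<lambda>\<omega>. r (Suc u) \<omega> * ?z \<omega>) \<omega>" for \<omega>
    using True by (simp add: cond_exp_vec_def r_def)
  with int show ?thesis by simp
next
  case False
  then have T: "Suc u = T" using u by simp
  have "m (Suc u) = (\<lambda>\<omega>. 1 + mu T \<omega>)"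
    by (subst mu_star.simps) (simp add: T)
  then show ?thesis using gross_return_moments(1)[OF u, of i] by (simp add: T r_def)
qed

text \<open>Backward induction from time \<open>T\<close>, where both coefficients are 1. The two
  claims go together, since positivity and the bound at \<open>Suc u\<close> both enter the
  one-period results that give them at \<open>u\<close>.\<close>

lemma coefficients:
  assumes "u \<le> T"
  shows "(AE \<omega> in M. 0 < rho u \<omega>) \<and> (AE \<omega> in M. (r u \<omega>)\<^sup>2 \<le> rho u \<omega>)"
  using assms
proof (induction u rule: inc_induct)
  case base
  then show ?case by (simp add: rho_def r_def)
next
  case (step u)
  then have pos: "AE \<omega> in M. 0 < rho (Suc u) \<omega>" and le: "AE \<omega> in M. (r (Suc u) \<omega>)\<^sup>2 \<le> rho (Suc u) \<omega>"
    and u: "u < T" by auto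
  interpret finite_measure_subalgebra M "F u" by (rule finite_subalgebra)
  have meas: "rho (Suc u) \<in> borel_measurable M" "r (Suc u) \<in> borel_measurable M"
    using rho_meas[of "Suc u"] r_meas[of "Suc u"] u by (auto intro: measurable_M)
  note prems = measurable_M[OF gross_return_meas[OF u]] meas pos le A_cond_exp[OF u]
    m_cond_exp[OF u le] gross_return_moments(2)[OF u] gross_return_pd[OF u] A_meas[OF u] m_meas[OF u]
  have "AE \<omega> in M. positive_definite (A (Suc u) \<omega>)" by (rule step_positive_definite[OF prems])
  then have "AE \<omega> in M. 0 < V_of (A (Suc u) \<omega>)" by eventually_elim (rule V_of_pos)
  then show ?case using step_R_of_square_le[OF prems] u by (simp add: rho_def r_def)
qed

lemmas rho_pos = coefficients[THEN conjunct1] and r_square_le = coefficients[THEN conjunct2]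

lemma one_step:
  assumes u: "u < T"
  shows "AE \<omega> in M. positive_definite (A (Suc u) \<omega>)"
    and "AE \<omega> in M. hedge b u \<omega> \<le> b\<^sup>2"
    and "y \<in> borel_measurable (F u) \<Longrightarrow> AE \<omega> in M. y \<omega> \<bullet> 1 = x \<omega> \<Longrightarrow>
      AE \<omega> in M. nn_cond_exp M (F u) (\<lambda>\<omega>. ennreal (loss b (Suc u) (y \<omega> \<bullet> (1 + X (Suc u) \<omega>)) \<omega>)) \<omega>
      + ennreal (hedge b u \<omega>) = ennreal (loss b u (x \<omega>) \<omega>)
      + ennreal ((y \<omega> - opt_amount b (A (Suc u) \<omega>) (m (Suc u) \<omega>) (x \<omega>)) \<bullet>
          (A (Suc u) \<omega> *v (y \<omega> - opt_amount b (A (Suc u) \<omega>) (m (Suc u) \<omega>) (x \<omega>))))"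
proof -
  interpret finite_measure_subalgebra M "F u" by (rule finite_subalgebra)
  have "Suc u \<le> T" using u by simp
  note le = r_square_le[OF this] and pos = rho_pos[OF this]
  have meas: "rho (Suc u) \<in> borel_measurable M" "r (Suc u) \<in> borel_measurable M"
    using rho_meas[of "Suc u"] r_meas[of "Suc u"] u by (auto intro: measurable_M)
  note prems = measurable_M[OF gross_return_meas[OF u]] meas pos le A_cond_exp[OF u]
    m_cond_exp[OF u le] gross_return_moments(2)[OF u] gross_return_pd[OF u] A_meas[OF u] m_meas[OF u]
  show "AE \<omega> in M. positive_definite (A (Suc u) \<omega>)" by (rule step_positive_definite[OF prems])
  show "AE \<omega> in M. hedge b u \<omega> \<le> b\<^sup>2" unfolding hedge_def by (rule step_constant_le[OF prems])
  assume "y \<in> borel_measurable (F u)" "AE \<omega> in M. y \<omega> \<bullet> 1 = x \<omega>"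
  from step_loss[OF prems this, of b]
  show "AE \<omega> in M. nn_cond_exp M (F u) (\<lambda>\<omega>. ennreal (loss b (Suc u) (y \<omega> \<bullet> (1 + X (Suc u) \<omega>)) \<omega>)) \<omega>
      + ennreal (hedge b u \<omega>) = ennreal (loss b u (x \<omega>) \<omega>)
      + ennreal ((y \<omega> - opt_amount b (A (Suc u) \<omega>) (m (Suc u) \<omega>) (x \<omega>)) \<bullet>
          (A (Suc u) \<omega> *v (y \<omega> - opt_amount b (A (Suc u) \<omega>) (m (Suc u) \<omega>) (x \<omega>))))"
    using u unfolding loss_def hedge_def by (simp add: rho_def[of u] r_def[of u])
qed

end

section \<open>The loss of a strategy and its decomposition over the periods\<close>

context portfolio_market
begin

lemma gap_zero_iff:
  "positive_definite (A (Suc u) \<omega>) \<Longrightarrow> gap b u x v \<omega> = 0 \<longleftrightarrow> gap_vec b u x v \<omega> = 0"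
  unfolding gap_def by (rule pd_quadratic_eq_0)

lemma gap_nonneg: "positive_definite (A (Suc u) \<omega>) \<Longrightarrow> 0 \<le> gap b u x v \<omega>"
  unfolding gap_def by (rule pd_quadratic_nonneg)

lemma opt_amount_meas:
  assumes u: "u < T" and [measurable]: "x \<in> borel_measurable (F u)"
  shows "(\<lambda>\<omega>. opt_amount b (A (Suc u) \<omega>) (m (Suc u) \<omega>) (x \<omega>)) \<in> borel_measurable (F u)"
proof -
  have [measurable]: "A (Suc u) \<in> borel_measurable (F u)" "m (Suc u) \<in> borel_measurable (F u)"
    using u by (rule A_meas m_meas)+
  show ?thesis unfolding opt_amount_def Q_of_mult by measurable
qed

lemma opt_weights_meas:
  assumes u: "u < T" and [measurable]: "x \<in> borel_measurable (F u)"
  shows "(\<lambda>\<omega>. opt_weights M F X mu Cov \<alpha> T u (x \<omega>) \<omega>) \<in> borel_measurable (F u)"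
proof -
  have [measurable]: "A (Suc u) \<in> borel_measurable (F u)" "m (Suc u) \<in> borel_measurable (F u)"
    using u by (rule A_meas m_meas)+
  show ?thesis unfolding opt_weights_def Let_def Q_of_mult Suc_eq_plus1[symmetric] by measurable
qed

context
  fixes s :: nat and W :: "'a \<Rightarrow> real"
  assumes s: "s < T" and W: "W \<in> borel_measurable (F s)"
begin

lemma wealth_meas:
  assumes w: "strategy M F T s w" and u: "s \<le> u" "u \<le> T"
  shows "wealth X s W w u \<in> borel_measurable (F u)"
  using u
proof (induction u rule: dec_induct)
  case base
  show ?case using W by (simp add: wealth_start)
next
  case (step u)
  have "wealth X s W w u \<in> borel_measurable (F u)" "w u \<in> borel_measurable (F u)"
    using step w by (auto simp: strategy_def)
  then have [measurable]: "wealth X s W w u \<in> borel_measurable (F (Suc u))" "w u \<in> borel_measurable (F (Suc u))"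
    by (auto intro: measurable_mono[of u "Suc u"])
  have [measurable]: "(\<lambda>\<omega>. 1 + X (Suc u) \<omega>) \<in> borel_measurable (F (Suc u))"
    using step by (intro gross_return_meas) auto
  show ?case using step by simp
qed

lemma amount_meas:
  assumes w: "strategy M F T s w" and u: "s \<le> u" "u < T"
  shows "(\<lambda>\<omega>. wealth X s W w u \<omega> *\<^sub>R w u \<omega>) \<in> borel_measurable (F u)"
proof -
  have [measurable]: "wealth X s W w u \<in> borel_measurable (F u)" "w u \<in> borel_measurable (F u)"
    using wealth_meas[OF w, of u] w u by (auto simp: strategy_def)
  show ?thesis by measurable
qed

abbreviation strategy_gap :: "real \<Rightarrow> (nat \<Rightarrow> 'a \<Rightarrow> real ^ 'k) \<Rightarrow> nat \<Rightarrow> 'a \<Rightarrow> real" where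
  "strategy_gap b w u \<omega> \<equiv> gap b u (wealth X s W w u \<omega>) (w u \<omega>) \<omega>"

abbreviation strategy_loss :: "real \<Rightarrow> (nat \<Rightarrow> 'a \<Rightarrow> real ^ 'k) \<Rightarrow> nat \<Rightarrow> 'a \<Rightarrow> real" where
  "strategy_loss b w u \<omega> \<equiv> loss b u (wealth X s W w u \<omega>) \<omega>"

lemma strategy_gap_meas:
  assumes w: "strategy M F T s w" and u: "s \<le> u" "u < T"
  shows "strategy_gap b w u \<in> borel_measurable M"
proof (rule measurable_M)
  have [measurable]: "(\<lambda>\<omega>. wealth X s W w u \<omega> *\<^sub>R w u \<omega>) \<in> borel_measurable (F u)"
    by (rule amount_meas[OF w u])
  have [measurable]: "(\<lambda>\<omega>. opt_amount b (A (Suc u) \<omega>) (m (Suc u) \<omega>) (wealth X s W w u \<omega>)) \<in> borel_measurable (F u)"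
    using u wealth_meas[OF w, of u] by (intro opt_amount_meas) auto
  have [measurable]: "A (Suc u) \<in> borel_measurable (F u)" using u by (intro A_meas)
  show "strategy_gap b w u \<in> borel_measurable (F u)" unfolding gap_def gap_vec_def by measurable
qed

lemma strategy_loss_meas:
  assumes w: "strategy M F T s w" and u: "s \<le> u" "u \<le> T"
  shows "strategy_loss b w u \<in> borel_measurable M"
proof (rule measurable_M)
  have [measurable]: "wealth X s W w u \<in> borel_measurable (F u)" "rho u \<in> borel_measurable (F u)"
      "r u \<in> borel_measurable (F u)"
    using wealth_meas[OF w u] rho_meas[OF u(2)] r_meas[OF u(2)] by auto
  show "strategy_loss b w u \<in> borel_measurable (F u)" unfolding loss_def by measurable
qed

lemma hedge_meas:
  assumes u: "u < T"
  shows "hedge b u \<in> borel_measurable M"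
proof (rule measurable_M)
  have [measurable]: "A (Suc u) \<in> borel_measurable (F u)" "m (Suc u) \<in> borel_measurable (F u)"
    using u by (rule A_meas m_meas)+
  show "hedge b u \<in> borel_measurable (F u)" unfolding hedge_def[abs_def] Q_of_mult by measurable
qed

text \<open>\<open>one_step\<close> is applied to the invested amounts, which add up to the current
  wealth because the weights add up to 1.\<close>

lemma strategy_loss_step:
  assumes w: "strategy M F T s w" and u: "s \<le> u" "u < T"
  shows "AE \<omega> in M. nn_cond_exp M (F u) (\<lambda>\<omega>. ennreal (strategy_loss b w (Suc u) \<omega>)) \<omega>
    + ennreal (hedge b u \<omega>) = ennreal (strategy_loss b w u \<omega>) + ennreal (strategy_gap b w u \<omega>)"
proof -
  let ?x = "wealth X s W w u"
  have sum: "AE \<omega> in M. (?x \<omega> *\<^sub>R w u \<omega>) \<bullet> 1 = ?x \<omega>"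
  proof -
    have "AE \<omega> in M. w u \<omega> \<bullet> 1 = 1" using w u by (auto simp: strategy_def)
    then show ?thesis by eventually_elim simp
  qed
  have "wealth X s W w (Suc u) \<omega> = (?x \<omega> *\<^sub>R w u \<omega>) \<bullet> (1 + X (Suc u) \<omega>)" for \<omega>
    using u by simp
  then show ?thesis
    using one_step(3)[OF u(2) amount_meas[OF w u] sum, of b] by (simp only: gap_def gap_vec_def)
qed

text \<open>The one-period identities are summed under the conditional expectation at time
  \<open>s\<close>. Keeping the hedge terms on one side and the gaps on the other avoids subtracting
  quantities that may be infinite.\<close>

lemma strategy_loss_telescope:
  assumes w: "strategy M F T s w" and u: "s \<le> u" "u \<le> T"
  shows "AE \<omega> in M. nn_cond_exp M (F s) (\<lambda>\<omega>. ennreal (strategy_loss b w u \<omega>)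
      + (\<Sum>j\<in>{s..<u}. ennreal (hedge b j \<omega>))) \<omega>
    = nn_cond_exp M (F s) (\<lambda>\<omega>. ennreal (loss b s (W \<omega>) \<omega>)
      + (\<Sum>j\<in>{s..<u}. ennreal (strategy_gap b w j \<omega>))) \<omega>"
  using u
proof (induction u rule: dec_induct)
  case base
  show ?case by (simp add: wealth_start)
next
  case (step u)
  \<comment> \<open>Wealth at \<open>Suc u\<close> stays folded, so that the next loss keeps the
    form used in \<open>strategy_loss_step\<close>.\<close>
  note wealth.simps [simp del]
  interpret finite_measure_subalgebra M "F s" by (rule finite_subalgebra)
  have u: "s \<le> u" "u < T" "u \<le> T" "s \<le> Suc u" "Suc u \<le> T" using step by auto
  let ?H = "\<lambda>\<omega>. \<Sum>j\<in>{s..<u}. ennreal (hedge b j \<omega>)"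
  let ?G = "\<lambda>\<omega>. \<Sum>j\<in>{s..<u}. ennreal (strategy_gap b w j \<omega>)"
  let ?L = "\<lambda>u \<omega>. ennreal (strategy_loss b w u \<omega>)"
  let ?h = "\<lambda>\<omega>. ennreal (hedge b u \<omega>)" and ?g = "\<lambda>\<omega>. ennreal (strategy_gap b w u \<omega>)"
  let ?I = "\<lambda>\<omega>. ennreal (loss b s (W \<omega>) \<omega>)"
  let ?N = "nn_cond_exp M (F u) (?L (Suc u))"
  have [measurable]: "?L u \<in> borel_measurable M" "?L (Suc u) \<in> borel_measurable M"
    using strategy_loss_meas[OF w u(1,3)] strategy_loss_meas[OF w u(4,5)] by auto
  have [measurable]: "?I \<in> borel_measurable M"
    using strategy_loss_meas[OF w order_refl, of b] s by (simp add: wealth_start)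
  have hm: "(\<lambda>\<omega>. ennreal (hedge b j \<omega>)) \<in> borel_measurable M" if "j < T" for j
    using hedge_meas[OF that] by simp
  have gm: "(\<lambda>\<omega>. ennreal (strategy_gap b w j \<omega>)) \<in> borel_measurable M" if "s \<le> j" "j < T" for j
    using strategy_gap_meas[OF w that] by simp
  have [measurable]: "?h \<in> borel_measurable M" "?g \<in> borel_measurable M" using hm gm u by auto
  have [measurable]: "?H \<in> borel_measurable M" "?G \<in> borel_measurable M"
    using hm gm u by (auto intro!: borel_measurable_sum)
  have [measurable]: "?N \<in> borel_measurable M" by simp
  have sums: "(\<Sum>j\<in>{s..<Suc u}. ennreal (hedge b j \<omega>)) = ?h \<omega> + ?H \<omega>"
    "(\<Sum>j\<in>{s..<Suc u}. ennreal (strategy_gap b w j \<omega>)) = ?g \<omega> + ?G \<omega>" for \<omega>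
    using u by (simp_all add: sum.atLeastLessThan_Suc add.commute)
  have 1: "AE \<omega> in M. nn_cond_exp M (F s) (?L (Suc u)) \<omega> + nn_cond_exp M (F s) (\<lambda>\<omega>. ?h \<omega> + ?H \<omega>) \<omega>
      = nn_cond_exp M (F s) (\<lambda>\<omega>. ?L (Suc u) \<omega> + (?h \<omega> + ?H \<omega>)) \<omega>"
    by (rule nn_cond_exp_sum) auto
  \<comment> \<open>The tower property inserts conditioning at the intermediate time
    \<open>u\<close>, where the one-period identity holds.\<close>
  have 2: "AE \<omega> in M. nn_cond_exp M (F s) (?L (Suc u)) \<omega> = nn_cond_exp M (F s) ?N \<omega>"
    by (rule nn_cond_exp_nested_subalg[OF portfolio_market.subalg[OF portfolio_market_axioms] subalgebra_mono[OF u(1)]]) simp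
  have 3: "AE \<omega> in M. nn_cond_exp M (F s) ?N \<omega> + nn_cond_exp M (F s) (\<lambda>\<omega>. ?h \<omega> + ?H \<omega>) \<omega>
      = nn_cond_exp M (F s) (\<lambda>\<omega>. ?N \<omega> + (?h \<omega> + ?H \<omega>)) \<omega>"
    by (rule nn_cond_exp_sum) auto
  have 4: "AE \<omega> in M. nn_cond_exp M (F s) (\<lambda>\<omega>. ?N \<omega> + (?h \<omega> + ?H \<omega>)) \<omega>
      = nn_cond_exp M (F s) (\<lambda>\<omega>. (?L u \<omega> + ?H \<omega>) + ?g \<omega>) \<omega>"
  proof (rule nn_cond_exp_cong)
    show "AE \<omega> in M. ?N \<omega> + (?h \<omega> + ?H \<omega>) = (?L u \<omega> + ?H \<omega>) + ?g \<omega>"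
      using strategy_loss_step[OF w u(1,2), of b]
    proof eventually_elim
      case (elim \<omega>)
      have "?N \<omega> + (?h \<omega> + ?H \<omega>) = (?N \<omega> + ?h \<omega>) + ?H \<omega>" by (simp only: add.assoc)
      also have "\<dots> = (?L u \<omega> + ?g \<omega>) + ?H \<omega>" using elim by (simp only:)
      finally show ?case by (simp only: ac_simps)
    qed
  qed auto
  have 5: "AE \<omega> in M. nn_cond_exp M (F s) (\<lambda>\<omega>. ?L u \<omega> + ?H \<omega>) \<omega> + nn_cond_exp M (F s) ?g \<omega>
      = nn_cond_exp M (F s) (\<lambda>\<omega>. (?L u \<omega> + ?H \<omega>) + ?g \<omega>) \<omega>"
    by (rule nn_cond_exp_sum) auto
  have 6: "AE \<omega> in M. nn_cond_exp M (F s) (\<lambda>\<omega>. ?I \<omega> + ?G \<omega>) \<omega> + nn_cond_exp M (F s) ?g \<omega>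
      = nn_cond_exp M (F s) (\<lambda>\<omega>. (?I \<omega> + ?G \<omega>) + ?g \<omega>) \<omega>"
    by (rule nn_cond_exp_sum) auto
  have IH: "AE \<omega> in M. nn_cond_exp M (F s) (\<lambda>\<omega>. ?L u \<omega> + ?H \<omega>) \<omega> = nn_cond_exp M (F s) (\<lambda>\<omega>. ?I \<omega> + ?G \<omega>) \<omega>"
    using step.IH u by simp
  have assoc: "(\<lambda>\<omega>. ?I \<omega> + (?g \<omega> + ?G \<omega>)) = (\<lambda>\<omega>. (?I \<omega> + ?G \<omega>) + ?g \<omega>)"
    by (simp add: ac_simps)
  show ?case
    unfolding sums assoc using 1 2 3 4 5 6 IH by eventually_elim metis
qed

text \<open>At \<open>T\<close> both coefficients are 1 and the loss is the squared distance from
  \<open>b\<close>; at \<open>s\<close> the loss is already known. Besides the terminal loss, only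
  the gap term depends on the strategy.\<close>

lemma terminal_loss:
  assumes w: "strategy M F T s w"
  shows "AE \<omega> in M. nn_cond_exp M (F s) (\<lambda>\<omega>. ennreal ((wealth X s W w T \<omega> - b)\<^sup>2)) \<omega>
      + nn_cond_exp M (F s) (\<lambda>\<omega>. \<Sum>j\<in>{s..<T}. ennreal (hedge b j \<omega>)) \<omega>
    = ennreal (loss b s (W \<omega>) \<omega>)
      + nn_cond_exp M (F s) (\<lambda>\<omega>. \<Sum>j\<in>{s..<T}. ennreal (strategy_gap b w j \<omega>)) \<omega>"
proof -
  interpret finite_measure_subalgebra M "F s" by (rule finite_subalgebra)
  have T: "s \<le> T" using s by simp
  have eq: "strategy_loss b w T \<omega> = (wealth X s W w T \<omega> - b)\<^sup>2" for \<omega>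
    by (simp add: loss_def rho_def r_def power2_eq_square algebra_simps)
  let ?H = "\<lambda>\<omega>. \<Sum>j\<in>{s..<T}. ennreal (hedge b j \<omega>)"
  let ?G = "\<lambda>\<omega>. \<Sum>j\<in>{s..<T}. ennreal (strategy_gap b w j \<omega>)"
  have [measurable]: "?H \<in> borel_measurable M" "?G \<in> borel_measurable M"
    using hedge_meas strategy_gap_meas[OF w] by (auto intro!: borel_measurable_sum)
  have [measurable]: "strategy_loss b w T \<in> borel_measurable M" by (rule strategy_loss_meas[OF w T order_refl])
  have [measurable]: "rho s \<in> borel_measurable (F s)" "r s \<in> borel_measurable (F s)"
      "W \<in> borel_measurable (F s)"
    using rho_meas[OF T] r_meas[OF T] W by auto
  have L0: "(\<lambda>\<omega>. loss b s (W \<omega>) \<omega>) \<in> borel_measurable (F s)" unfolding loss_def by measurable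
  have [measurable]: "(\<lambda>\<omega>. loss b s (W \<omega>) \<omega>) \<in> borel_measurable M" by (rule measurable_M[OF L0])
  have 1: "AE \<omega> in M. nn_cond_exp M (F s) (\<lambda>\<omega>. ennreal (strategy_loss b w T \<omega>)) \<omega> + nn_cond_exp M (F s) ?H \<omega>
      = nn_cond_exp M (F s) (\<lambda>\<omega>. ennreal (strategy_loss b w T \<omega>) + ?H \<omega>) \<omega>"
    by (rule nn_cond_exp_sum) auto
  have 2: "AE \<omega> in M. nn_cond_exp M (F s) (\<lambda>\<omega>. ennreal (loss b s (W \<omega>) \<omega>)) \<omega> + nn_cond_exp M (F s) ?G \<omega>
      = nn_cond_exp M (F s) (\<lambda>\<omega>. ennreal (loss b s (W \<omega>) \<omega>) + ?G \<omega>) \<omega>"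
    by (rule nn_cond_exp_sum) auto
  have 3: "AE \<omega> in M. ennreal (loss b s (W \<omega>) \<omega>) = nn_cond_exp M (F s) (\<lambda>\<omega>. ennreal (loss b s (W \<omega>) \<omega>)) \<omega>"
    by (rule nn_cond_exp_F_meas) (use L0 in simp)
  show ?thesis
    using 1 2 3 strategy_loss_telescope[OF w T order_refl, of b] unfolding eq by eventually_elim metis
qed

text \<open>Each summand is at most the square of \<open>b\<close>. Finiteness is what permits
  cancelling the hedge term in \<open>ennreal\<close>.\<close>

lemma hedge_sum_finite:
  "AE \<omega> in M. nn_cond_exp M (F s) (\<lambda>\<omega>. \<Sum>j\<in>{s..<T}. ennreal (hedge b j \<omega>)) \<omega> < \<infinity>"
proof -
  interpret finite_measure_subalgebra M "F s" by (rule finite_subalgebra)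
  have [measurable]: "(\<lambda>\<omega>. \<Sum>j\<in>{s..<T}. ennreal (hedge b j \<omega>)) \<in> borel_measurable M"
    using hedge_meas by (auto intro!: borel_measurable_sum)
  have "AE \<omega> in M. \<forall>j\<in>{s..<T}. hedge b j \<omega> \<le> b\<^sup>2"
    by (subst AE_finite_all) (auto intro: one_step(2))
  then have "AE \<omega> in M. nn_cond_exp M (F s) (\<lambda>\<omega>. \<Sum>j\<in>{s..<T}. ennreal (hedge b j \<omega>)) \<omega>
      \<le> nn_cond_exp M (F s) (\<lambda>\<omega>. \<Sum>j\<in>{s..<T}. ennreal (b\<^sup>2)) \<omega>"
    by (intro nn_cond_exp_mono, elim eventually_mono) (intro sum_mono ennreal_leI, auto)
  moreover have "AE \<omega> in M. (\<Sum>j\<in>{s..<T}. ennreal (b\<^sup>2)) = nn_cond_exp M (F s) (\<lambda>\<omega>. \<Sum>j\<in>{s..<T}. ennreal (b\<^sup>2)) \<omega>"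
    by (rule nn_cond_exp_F_meas) simp
  ultimately show ?thesis
  proof eventually_elim
    case (elim \<omega>)
    have "(\<Sum>j\<in>{s..<T}. ennreal (b\<^sup>2)) < \<infinity>" by (subst sum_ennreal) auto
    with elim(1)[unfolded elim(2)[symmetric]] show ?case by (rule le_less_trans)
  qed
qed

section \<open>Optimality as the vanishing of all gaps\<close>

definition invests_opt_amount :: "real \<Rightarrow> (nat \<Rightarrow> 'a \<Rightarrow> real ^ 'k) \<Rightarrow> bool" where
  "invests_opt_amount b w \<longleftrightarrow>
    (\<forall>u\<in>{s..<T}. AE \<omega> in M. gap_vec b u (wealth X s W w u \<omega>) (w u \<omega>) \<omega> = 0)"

text \<open>Positive definiteness makes each gap nonnegative, and zero only at the zero deviation. A
  sum of such terms has conditional expectation 0 exactly when every term vanishes almost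
  surely.\<close>

lemma invests_opt_amount_iff:
  assumes w: "strategy M F T s w"
  shows "invests_opt_amount b w \<longleftrightarrow>
    (AE \<omega> in M. nn_cond_exp M (F s) (\<lambda>\<omega>. \<Sum>j\<in>{s..<T}. ennreal (strategy_gap b w j \<omega>)) \<omega> = 0)"
proof -
  interpret finite_measure_subalgebra M "F s" by (rule finite_subalgebra)
  let ?G = "\<lambda>\<omega>. \<Sum>j\<in>{s..<T}. ennreal (strategy_gap b w j \<omega>)"
  have [measurable]: "?G \<in> borel_measurable M"
    using strategy_gap_meas[OF w] by (auto intro!: borel_measurable_sum)
  have pd: "AE \<omega> in M. \<forall>u\<in>{s..<T}. positive_definite (A (Suc u) \<omega>)"
    by (subst AE_finite_all) (auto intro: one_step(1))
  have "invests_opt_amount b w \<longleftrightarrow>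
      (AE \<omega> in M. \<forall>u\<in>{s..<T}. gap_vec b u (wealth X s W w u \<omega>) (w u \<omega>) \<omega> = 0)"
    unfolding invests_opt_amount_def by (subst AE_finite_all) auto
  also have "\<dots> \<longleftrightarrow> (AE \<omega> in M. ?G \<omega> = 0)"
  proof -
    have *: "AE \<omega> in M. (\<forall>u\<in>{s..<T}. gap_vec b u (wealth X s W w u \<omega>) (w u \<omega>) \<omega> = 0) \<longleftrightarrow> ?G \<omega> = 0"
      using pd
    proof eventually_elim
      case (elim \<omega>)
      have "?G \<omega> = 0 \<longleftrightarrow> (\<forall>u\<in>{s..<T}. strategy_gap b w u \<omega> \<le> 0)"
        by (subst sum_eq_0_iff) (auto simp: ennreal_eq_0_iff)
      also have "\<dots> \<longleftrightarrow> (\<forall>u\<in>{s..<T}. strategy_gap b w u \<omega> = 0)"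
        using gap_nonneg elim by (intro ball_cong) (auto intro: antisym)
      also have "\<dots> \<longleftrightarrow> (\<forall>u\<in>{s..<T}. gap_vec b u (wealth X s W w u \<omega>) (w u \<omega>) \<omega> = 0)"
        using gap_zero_iff elim by (intro ball_cong) auto
      finally show ?case by blast
    qed
    show ?thesis by (rule eventually_subst[OF *])
  qed
  also have "\<dots> \<longleftrightarrow> (AE \<omega> in M. nn_cond_exp M (F s) ?G \<omega> = 0)"
    by (rule nn_cond_exp_eq_0_iff[symmetric]) simp
  finally show ?thesis .
qed

lemma optimal_strategy_loss_iff:
  assumes \<alpha>: "0 < \<alpha>"
  shows "optimal_strategy M F X \<alpha> T s W w \<longleftrightarrow> strategy M F T s w \<and>
    (\<forall>v. strategy M F T s v \<longrightarrow>
      (AE \<omega> in M. nn_cond_exp M (F s) (\<lambda>\<omega>. ennreal ((wealth X s W w T \<omega> - 1 / \<alpha>)\<^sup>2)) \<omega>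
        \<le> nn_cond_exp M (F s) (\<lambda>\<omega>. ennreal ((wealth X s W v T \<omega> - 1 / \<alpha>)\<^sup>2)) \<omega>))"
proof -
  interpret finite_measure_subalgebra M "F s" by (rule finite_subalgebra)
  have T: "s \<le> T" using s by simp
  have u: "AE \<omega> in M. ereal_cond_exp M (F s) (\<lambda>\<omega>. utility \<alpha> (wealth X s W v T \<omega>)) \<omega> =
    ereal (1 / (2 * \<alpha>)) - ereal (\<alpha> / 2) *
      enn2ereal (nn_cond_exp M (F s) (\<lambda>\<omega>. ennreal ((wealth X s W v T \<omega> - 1 / \<alpha>)\<^sup>2)) \<omega>)"
    if "strategy M F T s v" for v
    by (rule ereal_cond_exp_utility[OF \<alpha> measurable_M[OF wealth_meas[OF that T order_refl]]])
  have "(AE \<omega> in M. ereal_cond_exp M (F s) (\<lambda>\<omega>. utility \<alpha> (wealth X s W v T \<omega>)) \<omega>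
        \<le> ereal_cond_exp M (F s) (\<lambda>\<omega>. utility \<alpha> (wealth X s W w T \<omega>)) \<omega>) \<longleftrightarrow>
      (AE \<omega> in M. nn_cond_exp M (F s) (\<lambda>\<omega>. ennreal ((wealth X s W w T \<omega> - 1 / \<alpha>)\<^sup>2)) \<omega>
        \<le> nn_cond_exp M (F s) (\<lambda>\<omega>. ennreal ((wealth X s W v T \<omega> - 1 / \<alpha>)\<^sup>2)) \<omega>)"
    if w: "strategy M F T s w" and v: "strategy M F T s v" for v
  proof -
    have *: "AE \<omega> in M. (ereal_cond_exp M (F s) (\<lambda>\<omega>. utility \<alpha> (wealth X s W v T \<omega>)) \<omega>
        \<le> ereal_cond_exp M (F s) (\<lambda>\<omega>. utility \<alpha> (wealth X s W w T \<omega>)) \<omega>) \<longleftrightarrow>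
      (nn_cond_exp M (F s) (\<lambda>\<omega>. ennreal ((wealth X s W w T \<omega> - 1 / \<alpha>)\<^sup>2)) \<omega>
        \<le> nn_cond_exp M (F s) (\<lambda>\<omega>. ennreal ((wealth X s W v T \<omega> - 1 / \<alpha>)\<^sup>2)) \<omega>)"
      using u[OF w] u[OF v] by eventually_elim (use \<alpha> in \<open>simp only: quadratic_ereal_le_iff[of "\<alpha> / 2"] half_gt_zero\<close>)
    show ?thesis by (rule eventually_subst[OF *])
  qed
  then show ?thesis unfolding optimal_strategy_def by blast
qed

text \<open>In \<open>terminal_loss\<close> the gap term of \<open>w\<close> is 0 and that of any
  competitor is nonnegative, while the other terms agree; the finite hedge term is then
  cancelled.\<close>

lemma invests_opt_amount_optimal:
  assumes \<alpha>: "0 < \<alpha>" and w: "strategy M F T s w" and opt: "invests_opt_amount (1 / \<alpha>) w"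
  shows "optimal_strategy M F X \<alpha> T s W w"
  unfolding optimal_strategy_loss_iff[OF \<alpha>]
proof (intro conjI allI impI w)
  fix v :: "nat \<Rightarrow> 'a \<Rightarrow> real ^ 'k" assume v: "strategy M F T s v"
  let ?b = "1 / \<alpha>"
  have "AE \<omega> in M. nn_cond_exp M (F s) (\<lambda>\<omega>. \<Sum>j\<in>{s..<T}. ennreal (strategy_gap ?b w j \<omega>)) \<omega> = 0"
    using opt invests_opt_amount_iff[OF w] by blast
  with terminal_loss[OF w, of ?b] terminal_loss[OF v, of ?b] hedge_sum_finite[of ?b]
  show "AE \<omega> in M. nn_cond_exp M (F s) (\<lambda>\<omega>. ennreal ((wealth X s W w T \<omega> - ?b)\<^sup>2)) \<omega>
        \<le> nn_cond_exp M (F s) (\<lambda>\<omega>. ennreal ((wealth X s W v T \<omega> - ?b)\<^sup>2)) \<omega>"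
  proof eventually_elim
    case (elim \<omega>)
    let ?C = "nn_cond_exp M (F s) (\<lambda>\<omega>. \<Sum>j\<in>{s..<T}. ennreal (hedge ?b j \<omega>)) \<omega>"
    have "?C + nn_cond_exp M (F s) (\<lambda>\<omega>. ennreal ((wealth X s W w T \<omega> - ?b)\<^sup>2)) \<omega>
      \<le> ?C + nn_cond_exp M (F s) (\<lambda>\<omega>. ennreal ((wealth X s W v T \<omega> - ?b)\<^sup>2)) \<omega>"
      unfolding add.commute[of ?C] elim(1,2,4) by simp
    then show ?case using elim(3) by (auto simp: ennreal_add_left_cancel_le)
  qed
qed

text \<open>Comparison with a strategy \<open>v\<close> without gaps leaves no room for a gap of an
  optimal strategy, because the initial loss is a finite number and cancels.\<close>

lemma optimal_invests_opt_amount: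
  assumes \<alpha>: "0 < \<alpha>" and opt: "optimal_strategy M F X \<alpha> T s W w"
    and v: "strategy M F T s v" and v_opt: "invests_opt_amount (1 / \<alpha>) v"
  shows "invests_opt_amount (1 / \<alpha>) w"
proof -
  let ?b = "1 / \<alpha>"
  have w: "strategy M F T s w" using opt by (simp add: optimal_strategy_def)
  have le: "AE \<omega> in M. nn_cond_exp M (F s) (\<lambda>\<omega>. ennreal ((wealth X s W w T \<omega> - ?b)\<^sup>2)) \<omega>
        \<le> nn_cond_exp M (F s) (\<lambda>\<omega>. ennreal ((wealth X s W v T \<omega> - ?b)\<^sup>2)) \<omega>"
    using opt v optimal_strategy_loss_iff[OF \<alpha>] by blast
  have "AE \<omega> in M. nn_cond_exp M (F s) (\<lambda>\<omega>. \<Sum>j\<in>{s..<T}. ennreal (strategy_gap ?b v j \<omega>)) \<omega> = 0"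
    using v_opt invests_opt_amount_iff[OF v] by blast
  with terminal_loss[OF w, of ?b] terminal_loss[OF v, of ?b] le
  have "AE \<omega> in M. nn_cond_exp M (F s) (\<lambda>\<omega>. \<Sum>j\<in>{s..<T}. ennreal (strategy_gap ?b w j \<omega>)) \<omega> = 0"
  proof eventually_elim
    case (elim \<omega>)
    let ?C = "nn_cond_exp M (F s) (\<lambda>\<omega>. \<Sum>j\<in>{s..<T}. ennreal (hedge ?b j \<omega>)) \<omega>"
    let ?G = "nn_cond_exp M (F s) (\<lambda>\<omega>. \<Sum>j\<in>{s..<T}. ennreal (strategy_gap ?b w j \<omega>)) \<omega>"
    have "ennreal (loss ?b s (W \<omega>) \<omega>) + ?G \<le> ennreal (loss ?b s (W \<omega>) \<omega>) + 0"
      using add_right_mono[OF elim(3), of ?C] unfolding elim(1,2,4) .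
    then have "?G \<le> 0" by (subst (asm) ennreal_add_left_cancel_le) simp
    then show ?case by simp
  qed
  then show ?thesis using invests_opt_amount_iff[OF w] by blast
qed

end

end

theorem theorem1:
  fixes M :: "'a measure" and F :: "nat \<Rightarrow> 'a measure"
    and X mu :: "nat \<Rightarrow> 'a \<Rightarrow> real ^ 'k" and Cov :: "nat \<Rightarrow> 'a \<Rightarrow> real ^ 'k ^ 'k"
    and \<alpha> :: real and T s :: nat and W :: "'a \<Rightarrow> real"
    and wstar :: "nat \<Rightarrow> real \<Rightarrow> 'a \<Rightarrow> real ^ 'k"
  assumes "prob_space M"
    and "filtration (space M) F" and "\<And>\<tau>. subalgebra M (F \<tau>)"
    and "\<And>\<tau>. \<tau> \<in> {0..T} \<Longrightarrow> X \<tau> \<in> borel_measurable (F \<tau>)"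
    and "\<And>\<tau> i. \<tau> \<in> {1..T} \<Longrightarrow> cond_integrable M (F (\<tau> - 1)) (\<lambda>\<omega>. (X \<tau> \<omega> $ i)\<^sup>2)"
    and "\<And>\<tau>. \<tau> \<in> {1..T} \<Longrightarrow> mu \<tau> \<in> borel_measurable (F (\<tau> - 1))"
    and "\<And>\<tau>. \<tau> \<in> {1..T} \<Longrightarrow> AE \<omega> in M. cond_exp_vec M (F (\<tau> - 1)) (X \<tau>) \<omega> = mu \<tau> \<omega>"
    and "\<And>\<tau>. \<tau> \<in> {1..T} \<Longrightarrow> Cov \<tau> \<in> borel_measurable (F (\<tau> - 1))"
    and "\<And>\<tau>. \<tau> \<in> {1..T} \<Longrightarrow> AE \<omega> in M. cond_var M (F (\<tau> - 1)) (X \<tau>) \<omega> = Cov \<tau> \<omega>"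
    and "\<And>\<tau>. \<tau> \<in> {1..T} \<Longrightarrow> AE \<omega> in M. positive_definite (Cov \<tau> \<omega>)"
    and "\<And>t i j. t \<in> {2..T} \<Longrightarrow> cond_integrable M (F (T - t))
           (\<lambda>\<omega>. V_coef M F X mu Cov T (T - t + 2) \<omega> *
              ((1 + X (T - t + 1) \<omega>) $ i * (1 + X (T - t + 1) \<omega>) $ j))"
    and "\<alpha> > 0"
    and "wstar = opt_weights M F X mu Cov \<alpha> T"
    and "s < T" and "W \<in> borel_measurable (F s)"
    and "\<And>u. u \<in> {s..<T} \<Longrightarrow> AE \<omega> in M. feedback_wealth X s W wstar u \<omega> \<noteq> 0"
  shows "optimal_strategy M F X \<alpha> T s W (feedback_strategy X s W wstar) \<and>
    (\<forall>w. optimal_strategy M F X \<alpha> T s W w \<longleftrightarrow> strategy M F T s w \<and>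
       (\<forall>t\<in>{1..T - s}. AE \<omega> in M.
          w (T - t) \<omega> = wstar (T - t) (wealth X s W w (T - t) \<omega>) \<omega>))"
proof -
  interpret portfolio_market M F X mu Cov T
    using assms(1-11) by (simp add: portfolio_market_def portfolio_market_axioms_def)
  note \<alpha> = \<open>\<alpha> > 0\<close> and wstar = \<open>wstar = opt_weights M F X mu Cov \<alpha> T\<close>
    and s = \<open>s < T\<close> and W = \<open>W \<in> borel_measurable (F s)\<close> and nonzero = assms(16)
  let ?fw = "feedback_wealth X s W wstar" and ?fs = "feedback_strategy X s W wstar"
  let ?opt = "invests_opt_amount s W (1 / \<alpha>)"
  \<comment> \<open>Multiplication by the wealth undoes the division in the formula for the weights,
    which is valid only away from wealth 0.\<close>
  have gap_wstar: "gap_vec (1 / \<alpha>) u x (wstar u x \<omega>) \<omega> = 0" if "x \<noteq> 0" for u x \<omega>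
    using scaled_opt_weights[OF that, of \<alpha> M F X mu Cov T u \<omega>] \<alpha> by (simp add: gap_vec_def wstar)
  have wstar_unique: "v = wstar u x \<omega>" if "x \<noteq> 0" "gap_vec (1 / \<alpha>) u x v \<omega> = 0" for u x v \<omega>
  proof -
    have "x *\<^sub>R v = x *\<^sub>R wstar u x \<omega>"
      using gap_wstar[OF that(1), of u \<omega>] that(2) by (simp add: gap_vec_def)
    then show ?thesis using that(1) by simp
  qed

  \<comment> \<open>Measurability of wealth and weights alternates: wealth known at \<open>u\<close>
    yields weights known at \<open>u\<close>, and these yield wealth known at
    \<open>Suc u\<close>.\<close>
  have fw_meas: "?fw u \<in> borel_measurable (F u)" if "s \<le> u" "u \<le> T" for u
    using that
  proof (induction u rule: dec_induct)
    case base
    then show ?case using W by (simp add: feedback_wealth_start)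
  next
    case (step u)
    then have fw: "?fw u \<in> borel_measurable (F u)" and u: "u < T" by auto
    have "(\<lambda>\<omega>. wstar u (?fw u \<omega>) \<omega>) \<in> borel_measurable (F u)"
      unfolding wstar by (rule opt_weights_meas[OF u fw[unfolded wstar]])
    then have [measurable]: "(\<lambda>\<omega>. wstar u (?fw u \<omega>) \<omega>) \<in> borel_measurable (F (Suc u))"
        "?fw u \<in> borel_measurable (F (Suc u))"
      using fw by (auto intro: measurable_mono[of u "Suc u"])
    have [measurable]: "(\<lambda>\<omega>. 1 + X (Suc u) \<omega>) \<in> borel_measurable (F (Suc u))"
      using u by (rule gross_return_meas)
    show ?case using step by simp
  qed
  have fs: "strategy M F T s ?fs"
    unfolding strategy_def
  proof (intro ballI conjI)
    fix u assume u: "u \<in> {s..<T}"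
    then have "u < T" "?fw u \<in> borel_measurable (F u)" using fw_meas by auto
    then show "?fs u \<in> borel_measurable (F u)"
      unfolding feedback_strategy_def[abs_def] wstar by (intro opt_weights_meas)
    show "AE \<omega> in M. ?fs u \<omega> \<bullet> 1 = 1"
      using one_step(1)[OF \<open>u < T\<close>]
      by eventually_elim (simp add: feedback_strategy_def wstar sum_opt_weights)
  qed
  have wealth_fs: "wealth X s W ?fs u = ?fw u" for u
    by (rule wealth_feedback_strategy)
  \<comment> \<open>The feedback wealth never vanishes, so the prescribed weights realise the
    optimal amounts at every time.\<close>
  have fs_opt: "?opt ?fs"
    unfolding invests_opt_amount_def[OF s W]
  proof
    fix u assume "u \<in> {s..<T}"
    from nonzero[OF this] show "AE \<omega> in M. gap_vec (1 / \<alpha>) u (wealth X s W ?fs u \<omega>) (?fs u \<omega>) \<omega> = 0"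
      by eventually_elim (simp add: wealth_fs feedback_strategy_def gap_wstar)
  qed

  text \<open>Both descriptions of the optimal strategies determine the wealth process, so along either of
    them the wealth is that of the feedback strategy and never vanishes.\<close>

  have wealth_eq: "AE \<omega> in M. wealth X s W w u \<omega> = ?fw u \<omega>"
    if u: "s \<le> u" "u \<le> T"
      and w: "\<And>u. u \<in> {s..<T} \<Longrightarrow> AE \<omega> in M. wealth X s W w u \<omega> \<noteq> 0 \<longrightarrow> w u \<omega> = wstar u (wealth X s W w u \<omega>) \<omega>"
    for w u
    using u
  proof (induction u rule: dec_induct)
    case base
    show ?case by (simp add: wealth_start feedback_wealth_start)
  next
    case (step u)
    then have "u \<in> {s..<T}" "AE \<omega> in M. wealth X s W w u \<omega> = ?fw u \<omega>" by auto
    from w[OF this(1)] nonzero[OF this(1)] this(2) show ?case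
      by eventually_elim (use step in simp)
  qed
  have wealth_nonzero: "AE \<omega> in M. wealth X s W w u \<omega> \<noteq> 0"
    if "u \<in> {s..<T}"
      and "\<And>u. u \<in> {s..<T} \<Longrightarrow> AE \<omega> in M. wealth X s W w u \<omega> \<noteq> 0 \<longrightarrow> w u \<omega> = wstar u (wealth X s W w u \<omega>) \<omega>"
    for w u
    using wealth_eq[of u w] that nonzero[OF that(1)] by (auto elim: AE_mp)
  have opt_iff: "?opt w \<longleftrightarrow> (\<forall>u\<in>{s..<T}. AE \<omega> in M. w u \<omega> = wstar u (wealth X s W w u \<omega>) \<omega>)" for w
  proof
    assume w: "?opt w"
    \<comment> \<open>The amounts determine the weights only where wealth is nonzero. This
      conditional form already fixes the wealth process, and \<open>wealth_nonzero\<close> then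
      removes the condition.\<close>
    have weak: "AE \<omega> in M. wealth X s W w u \<omega> \<noteq> 0 \<longrightarrow> w u \<omega> = wstar u (wealth X s W w u \<omega>) \<omega>"
      if "u \<in> {s..<T}" for u
    proof -
      have "AE \<omega> in M. gap_vec (1 / \<alpha>) u (wealth X s W w u \<omega>) (w u \<omega>) \<omega> = 0"
        using w that by (simp add: invests_opt_amount_def[OF s W])
      then show ?thesis by eventually_elim (auto intro: wstar_unique)
    qed
    show "\<forall>u\<in>{s..<T}. AE \<omega> in M. w u \<omega> = wstar u (wealth X s W w u \<omega>) \<omega>"
    proof
      fix u assume u: "u \<in> {s..<T}"
      have "AE \<omega> in M. wealth X s W w u \<omega> \<noteq> 0" by (rule wealth_nonzero[OF u weak])
      with weak[OF u]
      show "AE \<omega> in M. w u \<omega> = wstar u (wealth X s W w u \<omega>) \<omega>" by eventually_elim simp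
    qed
  next
    assume w: "\<forall>u\<in>{s..<T}. AE \<omega> in M. w u \<omega> = wstar u (wealth X s W w u \<omega>) \<omega>"
    show "?opt w"
      unfolding invests_opt_amount_def[OF s W]
    proof
      fix u assume u: "u \<in> {s..<T}"
      have "AE \<omega> in M. wealth X s W w u \<omega> \<noteq> 0"
      proof (rule wealth_nonzero[OF u])
        fix u assume "u \<in> {s..<T}"
        with w have "AE \<omega> in M. w u \<omega> = wstar u (wealth X s W w u \<omega>) \<omega>" by blast
        then show "AE \<omega> in M. wealth X s W w u \<omega> \<noteq> 0 \<longrightarrow> w u \<omega> = wstar u (wealth X s W w u \<omega>) \<omega>"
          by eventually_elim simp
      qed
      with w[rule_format, OF u]
      show "AE \<omega> in M. gap_vec (1 / \<alpha>) u (wealth X s W w u \<omega>) (w u \<omega>) \<omega> = 0"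
      proof eventually_elim
        case (elim \<omega>)
        show ?case by (subst elim(1)) (rule gap_wstar[OF elim(2)])
      qed
    qed
  qed
  \<comment> \<open>Periods are counted from the end: \<open>t = 1\<close> is the last decision time
    and \<open>t = T - s\<close> the first.\<close>
  have "u \<in> {s..<T} \<longleftrightarrow> (\<exists>t\<in>{1..T - s}. u = T - t)" for u
    using s by (auto intro!: bexI[of _ "T - u"])
  then have reindex: "(\<forall>u\<in>{s..<T}. P u) \<longleftrightarrow> (\<forall>t\<in>{1..T - s}. P (T - t))" for P :: "nat \<Rightarrow> bool"
    by metis
  show ?thesis
  proof (intro conjI allI)
    show "optimal_strategy M F X \<alpha> T s W ?fs"
      by (rule invests_opt_amount_optimal[OF s W \<alpha> fs fs_opt])
    fix w
    \<comment> \<open>The feedback strategy is the competitor without gaps required by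
      \<open>optimal_invests_opt_amount\<close>.\<close>
    have "optimal_strategy M F X \<alpha> T s W w \<longleftrightarrow> strategy M F T s w \<and> ?opt w"
      using invests_opt_amount_optimal[OF s W \<alpha>] optimal_invests_opt_amount[OF s W \<alpha> _ fs fs_opt]
      by (auto simp: optimal_strategy_def)
    then show "optimal_strategy M F X \<alpha> T s W w \<longleftrightarrow> strategy M F T s w \<and>
       (\<forall>t\<in>{1..T - s}. AE \<omega> in M. w (T - t) \<omega> = wstar (T - t) (wealth X s W w (T - t) \<omega>) \<omega>)"
      unfolding opt_iff reindex .
  qed
qed

end
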